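(* Let $B_\ell(t)$ be the outstanding balance at time $t$, under credit limit $\ell>0$, generated by the marked point process $A(t)=\sum_{i=1}^{N(t)}\xi_i$ with purchase-size distribution $F$ and inter-purchase-time distribution $G$, under the control policy that freezes the balance at the first attempted purchase that would make it exceed $\ell$. Let $\tilde f$ and $\tilde g$ be the Laplace transforms of $F$ and $G$. Then, for $\mathrm{Re}(\theta)>0$ and $\mathrm{Re}(\omega)>0$, $$\int_0^\infty\!\!\int_0^\infty e^{-(\omega t+\theta \ell)}\,\mathbf{E}[B_\ell(t)]\,d\ell\,dt \;=\; -\,\frac{\tilde g(\omega)}{\theta\,\omega\,\bigl(1-\tilde g(\omega)\tilde f(\theta)\bigr)}\,\frac{d}{d\theta}\tilde f(\theta).$$ Moreover, in the case where the derivative $\frac{\partial}{\partial \ell}\mathbf{E}[B_\ell(t)]$ exists (for all $\ell>0$ and $t>0$), $$\int_0^\infty\!\!\int_0^\infty e^{-(\omega t+\theta \ell)}\,\frac{\partial}{\partial \ell}\mathbf{E}[B_\ell(t)]\,d\ell\,dt \;=\; -\,\frac{\tilde g(\omega)}{\omega\,\bigl(1-\tilde g(\omega)\tilde f(\theta)\bigr)}\,\frac{d}{d\theta}\tilde f(\theta).$$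
   Context: Attempted purchases follow a marked point process $A(t)=\sum_{i=1}^{N(t)}\xi_i$, where $(\xi_i)_{i\ge1}$ are non-negative independent random variables with common distribution function $F$, and $N(t)$, independent of $(\xi_i)_{i\ge 1}$, is the number of events in $(0,t]$ of a renewal process with (positive) i.i.d. inter-event times with distribution function $G$ (the first event time also has distribution $G$). $F$ and $G$ are assumed to be of exponential order with all moments finite, so that the Laplace transforms $$\tilde f(\theta)=\int_0^\infty e^{-\theta z}F(dz),\qquad \tilde g(\omega)=\int_0^\infty e^{-\omega u}G(du)$$ exist for $\mathrm{Re}(\theta)>\sigma_F$ and $\mathrm{Re}(\omega)>\sigma_G$, where the abscissae of convergence $\sigma_F,\sigma_G$ are strictly negative. Control policy: the balance starts at $0$; if an attempted purchase would cause the outstanding balance to exceed the credit limit $\ell$, that purchase is rejected and no further purchases are allowed, so the balance stays frozen at its value just before that attempt. Equivalently, $B_\ell(t)=\sup_{0\le u\le t}\{A(u): A(u)\le \ell\}$. *)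

theory Defs
  imports "HOL-Probability.Probability"
begin

text \<open>
  Indices start at 0: \<open>\<xi> i\<close> is the size of attempted purchase number \<open>i + 1\<close>, and \<open>\<tau> i\<close> is the
  time between purchase attempts number \<open>i\<close> and \<open>i + 1\<close> (\<open>\<tau> 0\<close> is the time of the first attempt).
\<close>

definition arrival_time :: "(nat \<Rightarrow> 'a \<Rightarrow> real) \<Rightarrow> nat \<Rightarrow> 'a \<Rightarrow> real" where
  "arrival_time \<tau> n x = (\<Sum>i<n. \<tau> i x)"

text \<open>
  For i.i.d. positive \<open>\<tau>\<close> the set counted below is almost surely finite; on the exceptional null event
  \<open>card\<close> returns 0.
\<close>

definition renewal_count :: "(nat \<Rightarrow> 'a \<Rightarrow> real) \<Rightarrow> real \<Rightarrow> 'a \<Rightarrow> nat" where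
  "renewal_count \<tau> t x = card {n. 1 \<le> n \<and> arrival_time \<tau> n x \<in> {0<..t}}"

definition attempted_total ::
  "(nat \<Rightarrow> 'a \<Rightarrow> real) \<Rightarrow> (nat \<Rightarrow> 'a \<Rightarrow> real) \<Rightarrow> real \<Rightarrow> 'a \<Rightarrow> real" where
  "attempted_total \<xi> \<tau> t x = (\<Sum>i<renewal_count \<tau> t x. \<xi> i x)"

definition balance ::
  "(nat \<Rightarrow> 'a \<Rightarrow> real) \<Rightarrow> (nat \<Rightarrow> 'a \<Rightarrow> real) \<Rightarrow> real \<Rightarrow> real \<Rightarrow> 'a \<Rightarrow> real" where
  "balance \<xi> \<tau> l t x =
     Sup {attempted_total \<xi> \<tau> u x | u. 0 \<le> u \<and> u \<le> t \<and> attempted_total \<xi> \<tau> u x \<le> l}"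

text \<open>
  Integrals against a distribution function \<open>F\<close> on \<open>[0, \<infinity>)\<close> are Lebesgue-Stieltjes integrals over the
  closed half-line, so that a possible atom at 0 is included.
\<close>

definition laplace_stieltjes :: "(real \<Rightarrow> real) \<Rightarrow> complex \<Rightarrow> complex" where
  "laplace_stieltjes F \<theta> = (LINT z:{0..}|interval_measure F. exp (- \<theta> * complex_of_real z))"

text \<open>
  For an integral of \<open>exp (- \<theta> z)\<close> against a positive measure, convergence depends only on the real
  part of \<open>\<theta>\<close>, so real arguments suffice here. The value may be \<open>- \<infinity>\<close>.
\<close>

definition abscissa_of_convergence :: "(real \<Rightarrow> real) \<Rightarrow> ereal" where
  "abscissa_of_convergence F =
     Inf (ereal ` {s. set_integrable (interval_measure F) {0..} (\<lambda>z. exp (- s * z))})"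

text \<open>The \<open>\<sigma>\<close>-algebra on \<open>space M\<close> generated by the whole process \<open>(X i)\<close>, \<open>i \<in> I\<close>.\<close>

definition process_events ::
  "'a measure \<Rightarrow> 'i set \<Rightarrow> 'b measure \<Rightarrow> ('i \<Rightarrow> 'a \<Rightarrow> 'b) \<Rightarrow> 'a set set" where
  "process_events M I N X =
     sets (vimage_algebra (space M) (\<lambda>x. \<lambda>i\<in>I. X i x) (Pi\<^sub>M I (\<lambda>_. N)))"

text \<open>
  The next lemmas confirm that \<^const>\<open>balance\<close> is the balance under the policy that freezes it at the
  first attempted purchase that would make it exceed the limit.
\<close>

lemma arrival_time_strict_mono:
  assumes "\<And>i. 0 < \<tau> i x" and "m < n"
  shows "arrival_time \<tau> m x < arrival_time \<tau> n x"
  unfolding arrival_time_def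
  by (rule sum_strict_mono2) (use assms in \<open>auto intro: less_imp_le\<close>)

lemma arrival_time_le_iff:
  assumes "\<And>i. 0 < \<tau> i x"
  shows "arrival_time \<tau> m x \<le> arrival_time \<tau> n x \<longleftrightarrow> m \<le> n"
  using arrival_time_strict_mono[of \<tau> x, OF assms] by (metis linorder_not_le nle_le order_less_imp_le)

lemma arrival_time_pos:
  assumes "\<And>i. 0 < \<tau> i x" and "1 \<le> n"
  shows "0 < arrival_time \<tau> n x"
  using arrival_time_strict_mono[of \<tau> x 0 n] assms by (simp add: arrival_time_def)

lemma renewal_count_arrival_time:
  assumes "\<And>i. 0 < \<tau> i x"
  shows "renewal_count \<tau> (arrival_time \<tau> n x) x = n"
proof -
  have "{k. 1 \<le> k \<and> arrival_time \<tau> k x \<in> {0<..arrival_time \<tau> n x}} = {1..n}"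
    using arrival_time_le_iff[of \<tau> x, OF assms] arrival_time_pos[of \<tau> x, OF assms] by auto
  then show ?thesis by (simp add: renewal_count_def)
qed

lemma arrival_time_le:
  assumes "\<And>i. 0 < \<tau> i x" and "n \<le> renewal_count \<tau> t x" and "0 \<le> t"
  shows "arrival_time \<tau> n x \<le> t"
proof (rule ccontr)
  assume neg: "\<not> arrival_time \<tau> n x \<le> t"
  then have "1 \<le> n" using assms(3) by (cases n) (auto simp: arrival_time_def)
  have "k < n" if "arrival_time \<tau> k x \<le> t" for k
    using that neg arrival_time_le_iff[of \<tau> x n k, OF assms(1)] by linarith
  then have "{k. 1 \<le> k \<and> arrival_time \<tau> k x \<in> {0<..t}} \<subseteq> {1..<n}" by auto
  from card_mono[OF _ this] have "renewal_count \<tau> t x \<le> n - 1" by (simp add: renewal_count_def)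
  with assms(2) \<open>1 \<le> n\<close> show False by linarith
qed

lemma balance_before_freeze:
  assumes "\<And>i. 0 \<le> \<xi> i x" and "0 \<le> t"
    and "finite {n. 1 \<le> n \<and> arrival_time \<tau> n x \<in> {0<..t}}"
    and "attempted_total \<xi> \<tau> t x \<le> l"
  shows "balance \<xi> \<tau> l t x = attempted_total \<xi> \<tau> t x"
  unfolding balance_def
proof (rule cSup_eq_maximum)
  show "attempted_total \<xi> \<tau> t x \<in>
      {attempted_total \<xi> \<tau> u x | u. 0 \<le> u \<and> u \<le> t \<and> attempted_total \<xi> \<tau> u x \<le> l}"
    using assms(2,4) by auto
next
  fix y
  assume "y \<in> {attempted_total \<xi> \<tau> u x | u. 0 \<le> u \<and> u \<le> t \<and> attempted_total \<xi> \<tau> u x \<le> l}"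
  then obtain u where u: "u \<le> t" "y = attempted_total \<xi> \<tau> u x" by auto
  have "renewal_count \<tau> u x \<le> renewal_count \<tau> t x"
    unfolding renewal_count_def using u by (intro card_mono assms(3)) auto
  then show "y \<le> attempted_total \<xi> \<tau> t x"
    unfolding u(2) attempted_total_def by (intro sum_mono2) (auto simp: assms(1))
qed

lemma balance_after_freeze:
  assumes "\<And>i. 0 \<le> \<xi> i x" and "\<And>i. 0 < \<tau> i x" and "0 \<le> t"
    and "n < renewal_count \<tau> t x"
    and "(\<Sum>i<n. \<xi> i x) \<le> l" and "l < (\<Sum>i<Suc n. \<xi> i x)"
  shows "balance \<xi> \<tau> l t x = (\<Sum>i<n. \<xi> i x)"
  unfolding balance_def
proof (rule cSup_eq_maximum)
  have "attempted_total \<xi> \<tau> (arrival_time \<tau> n x) x = (\<Sum>i<n. \<xi> i x)"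
    by (simp add: attempted_total_def renewal_count_arrival_time[of \<tau> x, OF assms(2)])
  moreover have "arrival_time \<tau> n x \<le> t"
    using assms(4) by (intro arrival_time_le assms(2,3)) simp
  moreover have "0 \<le> arrival_time \<tau> n x"
    unfolding arrival_time_def using assms(2) by (intro sum_nonneg) (simp add: less_imp_le)
  ultimately show "(\<Sum>i<n. \<xi> i x) \<in>
      {attempted_total \<xi> \<tau> u x | u. 0 \<le> u \<and> u \<le> t \<and> attempted_total \<xi> \<tau> u x \<le> l}"
    using assms(5) by (auto intro!: exI[of _ "arrival_time \<tau> n x"])
next
  fix y
  assume "y \<in> {attempted_total \<xi> \<tau> u x | u. 0 \<le> u \<and> u \<le> t \<and> attempted_total \<xi> \<tau> u x \<le> l}"
  then obtain u where u: "y = attempted_total \<xi> \<tau> u x" "attempted_total \<xi> \<tau> u x \<le> l" by auto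
  have "renewal_count \<tau> u x \<le> n"
  proof (rule ccontr)
    assume "\<not> renewal_count \<tau> u x \<le> n"
    then have "(\<Sum>i<Suc n. \<xi> i x) \<le> attempted_total \<xi> \<tau> u x"
      unfolding attempted_total_def by (intro sum_mono2) (auto simp: assms(1))
    with u(2) assms(6) show False by linarith
  qed
  then show "y \<le> (\<Sum>i<n. \<xi> i x)"
    unfolding u(1) attempted_total_def by (intro sum_mono2) (auto simp: assms(1))
qed

end

(*
  Since purchase sizes are nonnegative, the n-th purchase is accepted by time t exactly when its
  arrival time T_n is at most t and the partial sum S_n is at most l, so
    B_l(t) = sum_n xi_n 1{T_n <= t} 1{S_n <= l}.
  This holds at every sample point, even where the arrival times accumulate. By independence the
  mean of each term is P(T_n <= t) E[xi_n; S_n <= l]. Integrating 1{X <= l} against exp (- theta l)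
  gives exp (- theta X) / theta, so the transforms of the two factors are g(omega)^n / omega and
  - f(theta)^(n-1) f'(theta) / theta, and what remains is a geometric series with ratio
  g(omega) f(theta).
  For the second identity, a nondecreasing everywhere differentiable function is the integral of its
  derivative, so by Fubini the transform of the derivative is theta times that of the function.
*)

theory Submission
  imports Defs
begin

text \<open>Two obstacles shape the proof. Independence is assumed between the purchase sizes and
  the counts \<open>renewal_count\<close>, not the gaps, and \<open>card\<close> returns 0 on an
  infinite set of arrivals. So the event that an arrival has occurred must be recovered from the
  counts at countably many times before the mean of a term can be factored. Secondly,
  \<open>mean_balance\<close> and its \<open>deriv\<close> are defined one point at a time, so joint
  measurability in \<open>(t, l)\<close> has to be built: from the series, whose terms are products
  of a function of \<open>t\<close> and a function of \<open>l\<close>, and for the derivative from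
  difference quotients. Joint integrability rests on one bound: the balance lies between 0 and
  \<open>l\<close>, so \<open>l * exp (- c * l)\<close> serves as the majorant. The real factors of
  the series are nonnegative, hence the norms of its terms sum exactly to the norm of the limit,
  which justifies exchanging sum and integral. The ratio has norm below 1 because positive gaps make
  the transform of \<open>G\<close> strictly smaller than 1 in norm, while that of \<open>F\<close>
  is at most 1.\<close>

section \<open>Laplace transforms of cumulative functions\<close>

text \<open>Half of the decay rate pays for the factor \<open>x\<close>: apply y \<le> exp y to y =
  c x / 2.\<close>

lemma mult_exp_le:
  fixes c x :: real
  assumes "0 < c"
  shows "x * exp (- c * x) \<le> 2 / c * exp (- (c / 2) * x)"
proof -
  have "c / 2 * x \<le> exp (c / 2 * x)"
    using exp_ge_add_one_self[of "c / 2 * x"] by linarith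
  then have "x \<le> 2 / c * exp (c / 2 * x)"
    using assms by (simp add: field_simps)
  then have "x * exp (- c * x) \<le> 2 / c * exp (c / 2 * x) * exp (- c * x)"
    by (intro mult_right_mono) auto
  also have "\<dots> = 2 / c * exp (- (c / 2) * x)"
    by (simp add: mult_exp_exp field_simps)
  finally show ?thesis .
qed

lemma nn_integral_exp_kernel:
  fixes c s :: real
  assumes "0 < c" "0 \<le> s"
  shows "(\<integral>\<^sup>+l. indicator {0<..} l * ennreal (exp (- c * l)) * indicator {s..} l \<partial>lborel)
    = ennreal (exp (- c * s) / c)"
proof -
  have "(\<integral>\<^sup>+l. indicator {0<..} l * ennreal (exp (- c * l)) * indicator {s..} l \<partial>lborel)
      = (\<integral>\<^sup>+l. ennreal (exp (- c * l)) * indicator {s..} l \<partial>lborel)"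
    \<comment> \<open>The integrands can differ only at \<open>l = 0\<close>, and only if
      \<open>s = 0\<close>.\<close>
    by (intro nn_integral_cong_AE eventually_mono[OF AE_lborel_singleton[of 0]])
       (use assms in \<open>auto split: split_indicator\<close>)
  also have "\<dots> = ennreal (0 - (- exp (- c * s) / c))"
  proof (rule nn_integral_FTC_atLeast[where F = "\<lambda>l. - exp (- c * l) / c"])
    show "((\<lambda>l. - exp (- c * l) / c) \<longlongrightarrow> 0) at_top"
      using assms by real_asymp
  qed (use assms in \<open>auto intro!: derivative_eq_intros\<close>)
  finally show ?thesis by simp
qed

lemma integrable_exp_kernel:
  fixes \<theta> :: complex
  assumes "0 < Re \<theta>"
  shows "set_integrable lborel {0<..} (\<lambda>l. exp (- \<theta> * of_real l))"
proof -
  have "(\<integral>\<^sup>+l. ennreal (norm (indicator {0<..} l *\<^sub>R exp (- \<theta> * of_real l))) \<partial>lborel)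
      = (\<integral>\<^sup>+l. indicator {0<..} l * ennreal (exp (- Re \<theta> * l)) * indicator {0..} l \<partial>lborel)"
    by (intro nn_integral_cong) (auto split: split_indicator)
  also have "\<dots> < \<infinity>"
    using nn_integral_exp_kernel[of "Re \<theta>" 0] assms by simp
  finally show ?thesis
    unfolding set_integrable_def by (intro integrableI_bounded) auto
qed

lemma integral_exp_kernel:
  fixes \<theta> :: complex and s :: real
  assumes "0 < Re \<theta>" "0 \<le> s"
  shows "(LINT l:{0<..}|lborel. exp (- \<theta> * of_real l) * indicator {s..} l) = exp (- \<theta> * of_real s) / \<theta>"
proof -
  have [simp]: "\<theta> \<noteq> 0" using assms by auto
  have int: "set_integrable lborel {s<..} (\<lambda>l. exp (- \<theta> * of_real l))"
    by (rule set_integrable_subset[OF integrable_exp_kernel]) (use assms in auto)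
  have "(LINT l:{0<..}|lborel. exp (- \<theta> * of_real l) * indicator {s..} l)
      = (LINT l:{s<..}|lborel. exp (- \<theta> * of_real l))"
    unfolding set_lebesgue_integral_def
    by (intro integral_cong_AE eventually_mono[OF AE_lborel_singleton[of s]])
       (use assms in \<open>auto split: split_indicator\<close>)
  also have "\<dots> = (LBINT l=ereal s..\<infinity>. exp (- \<theta> * of_real l))"
    by (simp add: interval_integral_to_infinity_eq)
  also have "\<dots> = 0 - (- exp (- \<theta> * of_real s) / \<theta>)"
  proof (rule interval_integral_FTC_integrable[where F = "\<lambda>l. - exp (- \<theta> * of_real l) / \<theta>"])
    show "((\<lambda>l. - exp (- \<theta> * of_real l) / \<theta>) has_vector_derivative exp (- \<theta> * of_real x)) (at x)" for x :: real
    proof -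
      have "((\<lambda>z. - exp (- \<theta> * z) / \<theta>) has_field_derivative exp (- \<theta> * of_real x)) (at (of_real x))"
        by (auto intro!: derivative_eq_intros)
      then show ?thesis
        by (rule has_vector_derivative_real_field)
    qed
    show "(((\<lambda>l. - exp (- \<theta> * complex_of_real l) / \<theta>) \<circ> real_of_ereal) \<longlongrightarrow>
        - exp (- \<theta> * complex_of_real s) / \<theta>) (at_right (ereal s))"
      unfolding ereal_tendsto_simps by (auto intro!: tendsto_eq_intros)
    have "((\<lambda>l. exp (- Re \<theta> * l)) \<longlongrightarrow> 0) at_top"
      using assms by real_asymp
    then have "((\<lambda>l. exp (- \<theta> * complex_of_real l)) \<longlongrightarrow> 0) at_top"
      by (subst tendsto_norm_zero_iff[symmetric]) (simp add: norm_exp_eq_Re)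
    then have "((\<lambda>l. - exp (- \<theta> * complex_of_real l) / \<theta>) \<longlongrightarrow> - 0 / \<theta>) at_top"
      by (intro tendsto_intros) auto
    then show "(((\<lambda>l. - exp (- \<theta> * complex_of_real l) / \<theta>) \<circ> real_of_ereal) \<longlongrightarrow> 0) (at_left \<infinity>)"
      unfolding ereal_tendsto_simps by simp
  qed (use int in \<open>auto intro!: continuous_intros simp: set_integrable_def\<close>)
  finally show ?thesis by simp
qed

context sigma_finite_measure
begin

text \<open>Tonelli: the point \<open>x\<close> contributes the weight \<open>W x\<close> from level
  \<open>X x\<close> onwards, so the inner integral over \<open>l\<close> is the tail of an
  exponential. This nonnegative form can establish finiteness before any integrability is
  known.\<close>

lemma nn_integral_laplace_cumulative:
  fixes X W :: "'a \<Rightarrow> real" and c :: real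
  assumes [measurable]: "X \<in> borel_measurable M" "W \<in> borel_measurable M"
    and "\<And>x. x \<in> space M \<Longrightarrow> 0 \<le> X x" and "0 < c"
  shows "(\<integral>\<^sup>+l. indicator {0<..} l * ennreal (exp (- c * l)) *
            (\<integral>\<^sup>+x. ennreal (W x) * indicator {X x..} l \<partial>M) \<partial>lborel)
       = (\<integral>\<^sup>+x. ennreal (W x) * ennreal (exp (- c * X x) / c) \<partial>M)"
proof -
  interpret P: pair_sigma_finite M lborel ..
  have "(\<integral>\<^sup>+l. indicator {0<..} l * ennreal (exp (- c * l)) *
            (\<integral>\<^sup>+x. ennreal (W x) * indicator {X x..} l \<partial>M) \<partial>lborel)
      = (\<integral>\<^sup>+l. \<integral>\<^sup>+x. ennreal (W x) * (indicator {0<..} l * ennreal (exp (- c * l)) * indicator {X x..} l) \<partial>M \<partial>lborel)"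
    by (intro nn_integral_cong, subst nn_integral_cmult[symmetric])
       (auto intro!: nn_integral_cong simp: ac_simps indicator_def)
  also have "\<dots> = (\<integral>\<^sup>+x. \<integral>\<^sup>+l. ennreal (W x) * (indicator {0<..} l * ennreal (exp (- c * l)) * indicator {X x..} l) \<partial>lborel \<partial>M)"
    by (rule P.Fubini') (simp add: indicator_def)
  also have "\<dots> = (\<integral>\<^sup>+x. ennreal (W x) * ennreal (exp (- c * X x) / c) \<partial>M)"
    by (intro nn_integral_cong, subst nn_integral_cmult)
       (use assms nn_integral_exp_kernel in \<open>auto simp: nn_integral_exp_kernel\<close>)
  finally show ?thesis .
qed

text \<open>The same exchange for a complex parameter. It is stated for sigma-finite measures
  because it serves three times: with \<open>X\<close> an arrival time and \<open>W = 1\<close>,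
  with \<open>X\<close> a partial sum and \<open>W\<close> its last summand, and with Lebesgue
  measure and \<open>W\<close> a derivative.\<close>

lemma laplace_cumulative:
  fixes X W :: "'a \<Rightarrow> real" and \<theta> :: complex
  assumes [measurable]: "X \<in> borel_measurable M" "W \<in> borel_measurable M"
    and X: "\<And>x. x \<in> space M \<Longrightarrow> 0 \<le> X x" and "0 < Re \<theta>"
    and int: "integrable M (\<lambda>x. W x * exp (- Re \<theta> * X x))"
  shows "set_integrable lborel {0<..}
           (\<lambda>l. exp (- \<theta> * of_real l) * of_real (LINT x|M. W x * indicator {X x..} l))" (is ?int)
    and "(LINT l:{0<..}|lborel. exp (- \<theta> * of_real l) * of_real (LINT x|M. W x * indicator {X x..} l))
       = (LINT x|M. of_real (W x) * exp (- \<theta> * of_real (X x))) / \<theta>" (is ?eq)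
proof -
  interpret P: pair_sigma_finite M lborel ..
  let ?k = "\<lambda>l x. indicator {0<..} l *\<^sub>R (exp (- \<theta> * complex_of_real l) * indicator {X x..} l)"
  let ?h = "\<lambda>x l. of_real (W x) * ?k l x"
  have nk: "(\<integral>\<^sup>+l. ennreal (norm (?k l x)) \<partial>lborel) = ennreal (exp (- Re \<theta> * X x) / Re \<theta>)"
    if "x \<in> space M" for x
    using nn_integral_exp_kernel[of "Re \<theta>" "X x"] X[OF that] assms(4)
    by (subst (asm) nn_integral_cong[where v = "\<lambda>l. ennreal (norm (?k l x))"]) (auto split: split_indicator)
  have H: "integrable (M \<Otimes>\<^sub>M lborel) (\<lambda>(x, l). ?h x l)"
  proof (rule integrableI_bounded)
    have norm_ennreal_meas: "(\<lambda>z::complex. ennreal (norm z)) \<in> borel_measurable borel"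
      by measurable
    show meas: "(\<lambda>(x, l). ?h x l) \<in> borel_measurable (M \<Otimes>\<^sub>M lborel)"
      by (simp add: indicator_def)
    have "(\<integral>\<^sup>+p. ennreal (norm (case p of (x, l) \<Rightarrow> ?h x l)) \<partial>(M \<Otimes>\<^sub>M lborel))
        = (\<integral>\<^sup>+x. \<integral>\<^sup>+l. ennreal (norm (?h x l)) \<partial>lborel \<partial>M)"
      using lborel.nn_integral_fst[OF measurable_compose[OF meas norm_ennreal_meas]]
      by (simp only: split_conv)
    also have "\<dots> = (\<integral>\<^sup>+x. ennreal (norm (W x)) * (\<integral>\<^sup>+l. ennreal (norm (?k l x)) \<partial>lborel) \<partial>M)"
      by (intro nn_integral_cong, subst nn_integral_cmult[symmetric])
         (auto simp: norm_mult ennreal_mult'[symmetric] ac_simps)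
    also have "\<dots> = (\<integral>\<^sup>+x. ennreal (norm (W x * exp (- Re \<theta> * X x) / Re \<theta>)) \<partial>M)"
      using assms(4)
      by (intro nn_integral_cong) (simp only: nk, simp add: ennreal_mult'[symmetric] abs_mult)
    also have "\<dots> < \<infinity>"
      using integrable_divide[OF int, of "Re \<theta>"] unfolding integrable_iff_bounded by auto
    finally show "(\<integral>\<^sup>+p. ennreal (norm (case p of (x, l) \<Rightarrow> ?h x l)) \<partial>(M \<Otimes>\<^sub>M lborel)) < \<infinity>" .
  qed
  have in_eq: "(LINT x|M. ?h x l) = indicator {0<..} l *\<^sub>R
      (exp (- \<theta> * of_real l) * of_real (LINT x|M. W x * indicator {X x..} l))" for l
  proof -
    have "(LINT x|M. ?h x l) = (LINT x|M. (indicator {0<..} l *\<^sub>R exp (- \<theta> * of_real l)) * of_real (W x * indicator {X x..} l))"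
      by (intro Bochner_Integration.integral_cong) (auto split: split_indicator)
    also have "\<dots> = (indicator {0<..} l *\<^sub>R exp (- \<theta> * of_real l)) * (LINT x|M. of_real (W x * indicator {X x..} l))"
      by (rule integral_mult_right_zero)
    finally show ?thesis
      by (simp only: integral_complex_of_real mult_scaleR_left)
  qed
  show ?int
    using P.integrable_snd[OF H] unfolding in_eq set_integrable_def .
  have "(LINT l:{0<..}|lborel. exp (- \<theta> * of_real l) * of_real (LINT x|M. W x * indicator {X x..} l))
      = (LINT l|lborel. LINT x|M. ?h x l)"
    unfolding in_eq set_lebesgue_integral_def ..
  also have "\<dots> = (LINT x|M. LINT l|lborel. ?h x l)"
    by (rule P.Fubini_integral[OF H])
  also have "\<dots> = (LINT x|M. of_real (W x) * exp (- \<theta> * of_real (X x)) / \<theta>)"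
    by (intro Bochner_Integration.integral_cong refl, subst integral_mult_right_zero)
       (use integral_exp_kernel[OF assms(4) X] in \<open>simp add: set_lebesgue_integral_def\<close>)
  finally show ?eq by simp
qed

end

text \<open>\<open>deriv\<close> is defined by choice, so the final formula has content only once
  the transform is known to be complex differentiable. The error of the difference quotient is
  bounded by a multiple of \<open>norm h\<close> uniformly in the sample point, using the
  second-order Taylor remainder of \<open>exp\<close>; the bound then survives integration.\<close>

lemma has_field_derivative_integral_exp:
  fixes \<theta> :: complex and Z :: "'a \<Rightarrow> real"
  assumes "prob_space M" and [measurable]: "Z \<in> borel_measurable M"
    and Z: "\<And>x. x \<in> space M \<Longrightarrow> 0 \<le> Z x" and "0 < Re \<theta>"
  shows "((\<lambda>\<theta>. LINT x|M. exp (- \<theta> * of_real (Z x))) has_field_derivative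
      - (LINT x|M. of_real (Z x) * exp (- \<theta> * of_real (Z x)))) (at \<theta>)"
proof -
  interpret prob_space M by fact
  define c where "c = Re \<theta>"
  have c: "0 < c" using assms by (simp add: c_def)
  \<comment> \<open>For \<open>norm h \<le> c / 2\<close> the remainder still decays at rate
    \<open>c / 2\<close>. Splitting this rate into two quarters gives the square of
    \<open>z * exp (- (c / 4 * z))\<close>, and each factor is at most
    \<open>2 / (c / 4) = 8 / c\<close>. The same radius keeps \<open>\<theta> + h\<close> in the
    right half-plane.\<close>
  define K where "K = (8 / c)\<^sup>2"
  let ?e = "\<lambda>\<theta> x. exp (- \<theta> * complex_of_real (Z x))"
  have le: "Z x * exp (- (a * Z x)) \<le> 2 / a" if "x \<in> space M" "0 < a" for x a
  proof -
    have "Z x * exp (- a * Z x) \<le> 2 / a * exp (- (a / 2) * Z x)"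
      by (rule mult_exp_le) fact
    also have "\<dots> \<le> 2 / a * 1"
      using Z[OF that(1)] that(2) by (intro mult_left_mono) auto
    finally show ?thesis by simp
  qed
  have i0: "integrable M (?e \<theta>')" if "0 \<le> Re \<theta>'" for \<theta>'
    using Z that by (intro integrable_const_bound[where B = 1]) (auto intro!: AE_I2)
  have i1: "integrable M (\<lambda>x. of_real (Z x) * ?e \<theta> x)"
    using le Z c by (intro integrable_const_bound[where B = "2 / c"]) (auto intro!: AE_I2 simp: norm_mult c_def)
  have bound: "norm ((?e (\<theta> + h) x - ?e \<theta> x) / h + of_real (Z x) * ?e \<theta> x) \<le> K * norm h"
    if x: "x \<in> space M" and h: "h \<noteq> 0" "norm h \<le> c / 2" for x and h :: complex
  proof -
    define z where "z = Z x"
    have z: "0 \<le> z" using Z[OF x] by (simp add: z_def)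
    define w where "w = - h * of_real z"
    have "(?e (\<theta> + h) x - ?e \<theta> x) / h + of_real (Z x) * ?e \<theta> x = ?e \<theta> x * (exp w - (1 + w)) / h"
    proof -
      have alg: "(e * v - e) / k + y * e = e * (v - (1 + - k * y)) / k" if "k \<noteq> 0" for e v k y :: complex
        using that by (simp add: field_simps)
      have "?e (\<theta> + h) x = ?e \<theta> x * exp w"
        by (simp add: w_def z_def exp_add[symmetric] algebra_simps)
      then show ?thesis
        using h(1) alg[OF h(1), of "?e \<theta> x" "exp w" "of_real z"] by (simp only: w_def z_def)
    qed
    also have "norm \<dots> = exp (- (c * z)) * norm (exp w - (1 + w)) / norm h"
      by (simp add: norm_mult norm_divide c_def z_def)
    also have "\<dots> \<le> exp (- (c * z)) * (exp (norm w) * (norm w)\<^sup>2) / norm h"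
      using Taylor_exp_field[of w 1] by (intro divide_right_mono mult_left_mono) (auto simp: numeral_2_eq_2)
    also have "\<dots> = norm h * (z\<^sup>2 * exp (norm h * z - c * z))"
    proof -
      have "norm w = norm h * z"
        using z by (simp add: w_def norm_mult)
      moreover have "exp (norm h * z - c * z) = exp (- (c * z)) * exp (norm h * z)"
        by (simp add: exp_add[symmetric])
      moreover have "e * (v * (k * y)\<^sup>2) / k = k * (y\<^sup>2 * (e * v))" if "k \<noteq> 0" for e v k y :: real
        using that by (simp add: power2_eq_square)
      ultimately show ?thesis
        using h(1) by (simp only: norm_eq_zero simp_thms)
    qed
    also have "\<dots> \<le> norm h * (z\<^sup>2 * exp (- (c / 4 * z) + - (c / 4 * z)))"
      using mult_right_mono[OF h(2) z] by (intro mult_left_mono) auto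
    also have "\<dots> = norm h * (z * exp (- (c / 4 * z)))\<^sup>2"
      unfolding exp_add by (simp add: power2_eq_square)
    also have "\<dots> \<le> norm h * (2 / (c / 4))\<^sup>2"
      using z c le[OF x, of "c / 4"] unfolding z_def[symmetric] by (intro mult_left_mono power_mono) auto
    finally show ?thesis by (simp add: K_def mult.commute)
  qed
  have diff: "norm (((LINT x|M. ?e (\<theta> + h) x) - (LINT x|M. ?e \<theta> x)) / h - - (LINT x|M. of_real (Z x) * ?e \<theta> x))
      \<le> norm h * K"
    if h: "h \<noteq> 0" "norm h \<le> c / 2" for h
  proof -
    have "0 \<le> Re (\<theta> + h)"
      using h(2) abs_Re_le_cmod[of h] c unfolding c_def plus_complex.sel by linarith
    note int = i0[OF this] i0[of \<theta>, OF less_imp_le[OF assms(4)]]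
    have int_q: "integrable M (\<lambda>x. (?e (\<theta> + h) x - ?e \<theta> x) / h)"
      by (rule integrable_divide[OF Bochner_Integration.integrable_diff[OF int]])
    have "((LINT x|M. ?e (\<theta> + h) x) - (LINT x|M. ?e \<theta> x)) / h - - (LINT x|M. of_real (Z x) * ?e \<theta> x)
        = (LINT x|M. (?e (\<theta> + h) x - ?e \<theta> x) / h) + (LINT x|M. of_real (Z x) * ?e \<theta> x)"
      by (simp only: Bochner_Integration.integral_diff[OF int] integral_divide_zero diff_minus_eq_add)
    also have "\<dots> = (LINT x|M. (?e (\<theta> + h) x - ?e \<theta> x) / h + of_real (Z x) * ?e \<theta> x)"
      by (rule Bochner_Integration.integral_add[OF int_q i1, symmetric])
    finally have eq: "((LINT x|M. ?e (\<theta> + h) x) - (LINT x|M. ?e \<theta> x)) / h - - (LINT x|M. of_real (Z x) * ?e \<theta> x)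
        = (LINT x|M. (?e (\<theta> + h) x - ?e \<theta> x) / h + of_real (Z x) * ?e \<theta> x)" .
    have "norm (LINT x|M. (?e (\<theta> + h) x - ?e \<theta> x) / h + of_real (Z x) * ?e \<theta> x) \<le> (LINT x|M. norm ((?e (\<theta> + h) x - ?e \<theta> x) / h + of_real (Z x) * ?e \<theta> x))"
      by (rule integral_norm_bound)
    also have "\<dots> \<le> (LINT x|M. K * norm h)"
    proof (rule integral_mono)
      show "integrable M (\<lambda>x. norm ((?e (\<theta> + h) x - ?e \<theta> x) / h + of_real (Z x) * ?e \<theta> x))"
        by (rule integrable_norm[OF Bochner_Integration.integrable_add[OF int_q i1]])
    next
      fix x assume "x \<in> space M"
      from bound[OF this h] show "norm ((?e (\<theta> + h) x - ?e \<theta> x) / h + of_real (Z x) * ?e \<theta> x) \<le> K * norm h" .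
    qed simp
    also have "\<dots> = norm h * K"
      by (simp add: prob_space)
    finally show ?thesis unfolding eq .
  qed
  have "((\<lambda>h. ((LINT x|M. ?e (\<theta> + h) x) - (LINT x|M. ?e \<theta> x)) / h - - (LINT x|M. of_real (Z x) * ?e \<theta> x)) \<longlongrightarrow> 0) (at 0)"
  proof (rule tendsto_0_le[where f = "\<lambda>h::complex. h"])
    show "\<forall>\<^sub>F h in at 0. norm (((LINT x|M. ?e (\<theta> + h) x) - (LINT x|M. ?e \<theta> x)) / h - - (LINT x|M. of_real (Z x) * ?e \<theta> x))
        \<le> norm h * K"
      using c unfolding eventually_at
      by (intro exI[of _ "c / 2"] conjI ballI impI diff) (simp_all add: dist_norm)
  qed auto
  then show ?thesis
    unfolding DERIV_def by (rule LIM_zero_cancel)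
qed

section \<open>Iterated integrals and the transform of a derivative\<close>

lemma set_integral_times_fst:
  fixes f :: "real \<Rightarrow> real \<Rightarrow> 'b::{banach, second_countable_topology}"
  assumes "set_integrable (lborel \<Otimes>\<^sub>M lborel) (A \<times> B) (\<lambda>(t, l). f t l)"
  shows "(LINT t:A|lborel. LINT l:B|lborel. f t l) = (LINT p:A \<times> B|lborel \<Otimes>\<^sub>M lborel. case p of (t, l) \<Rightarrow> f t l)"
proof -
  have "(LINT p:A \<times> B|lborel \<Otimes>\<^sub>M lborel. case p of (t, l) \<Rightarrow> f t l)
      = (LINT t|lborel. LINT l|lborel. indicator (A \<times> B) (t, l) *\<^sub>R f t l)"
    using lborel_pair.integral_fst'[OF assms[unfolded set_integrable_def]]
    unfolding set_lebesgue_integral_def by simp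
  also have "\<dots> = (LINT t:A|lborel. LINT l:B|lborel. f t l)"
    unfolding set_lebesgue_integral_def
    by (intro Bochner_Integration.integral_cong refl) (auto simp: indicator_times split: split_indicator)
  finally show ?thesis by simp
qed

text \<open>The majorant behind the integrability arguments for functions that grow at most like
  \<open>l\<close>, as the mean balance does.\<close>

lemma set_integrable_linear_mult_exp:
  fixes c :: real
  assumes "0 < c"
  shows "set_integrable lborel {0<..} (\<lambda>l. l * exp (- c * l))"
proof (rule set_integrable_bound)
  have "set_integrable lborel {0<..} (\<lambda>l. norm (exp (- complex_of_real (c / 2) * of_real l)))"
    using integrable_exp_kernel[of "complex_of_real (c / 2)"] assms by (intro set_integrable_norm) simp
  then show "set_integrable lborel {0<..} (\<lambda>l. 2 / c * exp (- (c / 2) * l))"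
    by (intro set_integrable_mult_right) simp
  show "AE l in lborel. l \<in> {0<..} \<longrightarrow> norm (l * exp (- c * l)) \<le> norm (2 / c * exp (- (c / 2) * l))"
    using mult_exp_le[OF assms] assms by (auto simp: abs_mult)
qed (simp add: set_borel_measurable_def)

text \<open>Difference quotients along a sequence: countable limits carry measurability and
  nonnegativity over to \<open>deriv\<close>.\<close>

lemma deriv_LIMSEQ:
  fixes f :: "real \<Rightarrow> real"
  assumes "f differentiable at x"
  shows "(\<lambda>n. (f (x + 1 / real (Suc n)) - f x) * real (Suc n)) \<longlonglongrightarrow> deriv f x"
proof -
  have "((\<lambda>h. (f (x + h) - f x) / h) \<longlongrightarrow> deriv f x) (at 0)"
    using assms unfolding DERIV_deriv_iff_real_differentiable[symmetric] DERIV_def .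
  moreover have "filterlim (\<lambda>n. 1 / real (Suc n)) (at 0) sequentially"
    using LIMSEQ_inverse_real_of_nat by (intro filterlim_atI) (auto simp: inverse_eq_divide)
  ultimately show ?thesis
    by (auto dest: filterlim_compose)
qed

text \<open>The derivative need not be continuous, so the fundamental theorem is used for the gauge
  integral, which integrates every derivative; monotonicity makes the derivative nonnegative and
  thereby turns the result into a Lebesgue integral. The bounds 0 \<le> f l \<le> l force the limit
  0 at the origin, so no boundary term appears, and they also give convergence.\<close>

lemma laplace_derivative:
  fixes f :: "real \<Rightarrow> real" and \<theta> :: complex
  assumes diff: "\<And>l. 0 < l \<Longrightarrow> f differentiable at l"
    and mono: "\<And>l l'. 0 < l \<Longrightarrow> l \<le> l' \<Longrightarrow> f l \<le> f l'"
    and f0: "\<And>l. 0 < l \<Longrightarrow> 0 \<le> f l" and fl: "\<And>l. 0 < l \<Longrightarrow> f l \<le> l" and "0 < Re \<theta>"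
  shows "set_integrable lborel {0<..} (\<lambda>l. exp (- \<theta> * of_real l) * of_real (deriv f l))"
    and "(LINT l:{0<..}|lborel. exp (- \<theta> * of_real l) * of_real (deriv f l))
      = \<theta> * (LINT l:{0<..}|lborel. exp (- \<theta> * of_real l) * of_real (f l))"
proof -
  define c where "c = Re \<theta>"
  have c: "0 < c" using assms by (simp add: c_def)
  define g where "g s = indicator {0<..} s * deriv f s" for s :: real
  \<comment> \<open>\<open>g\<close> vanishes on the negative half-line; \<open>max 0\<close> only meets the sign condition of \<open>laplace_cumulative\<close>.\<close>
  let ?m = "\<lambda>s::real. max 0 s"
  have D: "(f has_real_derivative deriv f l) (at l)" if "0 < l" for l
    using diff[OF that] by (simp add: DERIV_deriv_iff_real_differentiable)
  have nonneg: "0 \<le> deriv f l" if "0 < l" for l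
    by (rule LIMSEQ_le_const[OF deriv_LIMSEQ[OF diff[OF that]]]) (use mono that in auto)
  then have g0: "0 \<le> g s" for s by (simp add: g_def split: split_indicator)
  have contf: "continuous_on {0<..} f"
    using D by (auto intro!: continuous_at_imp_continuous_on DERIV_isCont)
  have [measurable]: "(\<lambda>l. indicator {0<..} l * f l) \<in> borel_measurable borel"
    using borel_measurable_continuous_on_indicator[OF _ contf] by simp
  have [measurable]: "g \<in> borel_measurable borel"
  proof (rule borel_measurable_LIMSEQ_real)
    \<comment> \<open>\<open>f\<close> is known to be continuous only on the positive half-line, so
      each of its values carries its own indicator.\<close>
    let ?q = "\<lambda>n s. indicator {0<..} s *
      ((indicator {0<..} (s + 1 / real (Suc n)) * f (s + 1 / real (Suc n)) - indicator {0<..} s * f s) * real (Suc n))"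
    show "?q n \<in> borel_measurable borel" for n
      by measurable
    show "(\<lambda>n. ?q n s) \<longlonglongrightarrow> g s" for s
    proof (cases "0 < s")
      case True
      then have "0 < s + 1 / real (Suc n)" for n by (simp add: add_pos_pos)
      with True show ?thesis using deriv_LIMSEQ[OF diff[OF True]] by (simp add: g_def)
    qed (simp add: g_def)
  qed
  have nn: "(\<integral>\<^sup>+s. ennreal (g s) * indicator {?m s..} l \<partial>lborel) = ennreal (f l)" if l: "0 < l" for l
  proof -
    \<comment> \<open>Nothing is known about \<open>f 0\<close>; the squeeze between 0 and
      \<open>s\<close> makes the extension by 0 continuous at the origin.\<close>
    let ?h = "\<lambda>s. if s \<le> 0 then 0 else f s"
    have "(g has_integral (?h l - ?h 0)) {0..l}"
    proof (rule fundamental_theorem_of_calculus_interior)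
      have "continuous (at s within {0..l}) ?h" if "s \<in> {0..l}" for s
      proof (cases "s = 0")
        case True
        have "((\<lambda>s. ?h s) \<longlongrightarrow> 0) (at 0)"
          by (rule tendsto_0_le[where f = "\<lambda>s. s" and K = 1])
             (use f0 fl in \<open>auto intro!: always_eventually\<close>)
        then show ?thesis
          using True by (auto simp: continuous_within intro: tendsto_within_subset)
      next
        case False
        then have "0 < s" using that by auto
        have "isCont f s" using D[OF \<open>0 < s\<close>] by (rule DERIV_isCont)
        moreover have "\<forall>\<^sub>F s in nhds s. f s = ?h s"
          using eventually_nhds_in_open[of "{0<..}" s] \<open>0 < s\<close> by (auto elim!: eventually_mono)
        ultimately have "isCont ?h s" using isCont_cong[of f ?h s] by simp
        then show ?thesis by (rule continuous_at_imp_continuous_at_within)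
      qed
      then show "continuous_on {0..l} ?h" by (simp add: continuous_on_eq_continuous_within)
      show "(?h has_vector_derivative g s) (at s)" if "s \<in> {0<..<l}" for s
      proof -
        have "(f has_vector_derivative g s) (at s)"
          using D[of s] that by (simp add: g_def has_real_derivative_iff_has_vector_derivative)
        then show ?thesis
          by (rule has_vector_derivative_transform_within_open[where S = "{0<..<l}"]) (use that in auto)
      qed
    qed (use l in simp)
    \<comment> \<open>Nonnegativity of \<open>g\<close> converts the gauge integral into a Lebesgue
      integral.\<close>
    from nn_integral_has_integral_lebesgue'[OF g0 this] l
    have "(\<integral>\<^sup>+s. ennreal (g s) * indicator {0..l} s \<partial>lborel) = ennreal (f l)" by simp
    moreover have "(\<integral>\<^sup>+s. ennreal (g s) * indicator {?m s..} l \<partial>lborel)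
        = (\<integral>\<^sup>+s. ennreal (g s) * indicator {0..l} s \<partial>lborel)"
      by (intro nn_integral_cong) (use l in \<open>auto simp: g_def split: split_indicator\<close>)
    ultimately show ?thesis by simp
  qed
  have real: "(LINT s|lborel. g s * indicator {?m s..} l) = f l" if l: "0 < l" for l
  proof -
    have "(\<integral>\<^sup>+s. ennreal (g s * indicator {?m s..} l) \<partial>lborel) = ennreal (f l)"
      unfolding nn[OF l, symmetric] by (intro nn_integral_cong) (auto split: split_indicator)
    then show ?thesis
      using g0 f0[OF l] by (subst integral_eq_nn_integral) (auto simp: indicator_def)
  qed
  \<comment> \<open>Integrability of \<open>g\<close> against the exponential comes from reading
    Tonelli backwards: the inner integral is \<open>f l\<close>, and
    \<open>f l \<le> l\<close>.\<close>
  have "(\<integral>\<^sup>+s. ennreal (g s) * ennreal (exp (- c * ?m s) / c) \<partial>lborel)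
      = (\<integral>\<^sup>+l. indicator {0<..} l * ennreal (exp (- c * l)) *
          (\<integral>\<^sup>+s. ennreal (g s) * indicator {?m s..} l \<partial>lborel) \<partial>lborel)"
    using c by (intro lborel.nn_integral_laplace_cumulative[symmetric]) auto
  also have "\<dots> \<le> (\<integral>\<^sup>+l. ennreal (norm (indicator {0<..} l *\<^sub>R (l * exp (- c * l)))) \<partial>lborel)"
    by (intro nn_integral_mono)
       (auto simp: nn abs_mult ennreal_mult''[symmetric] mult.commute intro!: ennreal_leI mult_right_mono fl
         split: split_indicator)
  also have "\<dots> < \<infinity>"
    using set_integrable_linear_mult_exp[OF c] unfolding set_integrable_def integrable_iff_bounded by blast
  finally have "(\<integral>\<^sup>+s. ennreal (norm (g s * exp (- c * ?m s) / c)) \<partial>lborel) < \<infinity>"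
    using g0 c by (simp add: ennreal_mult'[symmetric])
  then have "integrable lborel (\<lambda>s. c * (g s * exp (- c * ?m s) / c))"
    by (intro integrable_mult_right integrableI_bounded) measurable
  then have int: "integrable lborel (\<lambda>s. g s * exp (- Re \<theta> * ?m s))"
    using c by (simp add: c_def)
  have eq: "of_real (g s) * exp (- \<theta> * of_real (?m s))
      = indicator {0<..} s *\<^sub>R (exp (- \<theta> * of_real s) * of_real (deriv f s))" for s
    by (simp add: g_def split: split_indicator)
  have "integrable lborel (\<lambda>s. of_real (g s) * exp (- \<theta> * of_real (?m s)))"
  proof (rule integrableI_bounded)
    show "(\<integral>\<^sup>+s. ennreal (norm (of_real (g s) * exp (- \<theta> * of_real (?m s)))) \<partial>lborel) < \<infinity>"
      using int g0 by (simp add: integrable_iff_bounded norm_mult abs_mult)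
  qed measurable
  then show "set_integrable lborel {0<..} (\<lambda>l. exp (- \<theta> * of_real l) * of_real (deriv f l))"
    unfolding eq set_integrable_def .
  have "(LINT l:{0<..}|lborel. exp (- \<theta> * of_real l) * of_real (f l))
      = (LINT l:{0<..}|lborel. exp (- \<theta> * of_real l) * of_real (LINT s|lborel. g s * indicator {?m s..} l))"
    by (intro set_lebesgue_integral_cong) (auto simp: real)
  also have "\<dots> = (LINT s|lborel. of_real (g s) * exp (- \<theta> * of_real (?m s))) / \<theta>"
    by (rule lborel.laplace_cumulative) (use int assms in auto)
  finally show "(LINT l:{0<..}|lborel. exp (- \<theta> * of_real l) * of_real (deriv f l))
      = \<theta> * (LINT l:{0<..}|lborel. exp (- \<theta> * of_real l) * of_real (f l))"
    using assms(5) unfolding eq set_lebesgue_integral_def by auto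
qed

section \<open>The balance at a sample point\<close>

text \<open>Replaces real times by indices: the count \<open>n\<close> is attained at time
  \<open>arrival_time \<tau> n x\<close>, and a count attained at \<open>u\<close> has its arrival
  time at or before \<open>u\<close>. Both hold even if arrivals accumulate.\<close>

lemma attempted_totals_eq:
  assumes "\<And>i. 0 < \<tau> i x"
  shows "{attempted_total \<xi> \<tau> u x | u. 0 \<le> u \<and> u \<le> t \<and> attempted_total \<xi> \<tau> u x \<le> l}
    = {(\<Sum>i<n. \<xi> i x) | n. arrival_time \<tau> n x \<le> t \<and> (\<Sum>i<n. \<xi> i x) \<le> l}" (is "?A = ?B")
proof
  show "?A \<subseteq> ?B"
  proof
    fix y assume "y \<in> ?A"
    then obtain u where u: "0 \<le> u" "u \<le> t" "y = attempted_total \<xi> \<tau> u x" "y \<le> l" by auto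
    have "arrival_time \<tau> (renewal_count \<tau> u x) x \<le> u"
      by (rule arrival_time_le) (use assms u in auto)
    with u show "y \<in> ?B"
      unfolding attempted_total_def by (auto intro!: exI[of _ "renewal_count \<tau> u x"])
  qed
  show "?B \<subseteq> ?A"
  proof
    fix y assume "y \<in> ?B"
    then obtain n where n: "y = (\<Sum>i<n. \<xi> i x)" "arrival_time \<tau> n x \<le> t" "y \<le> l" by auto
    have "attempted_total \<xi> \<tau> (arrival_time \<tau> n x) x = y"
      by (simp add: attempted_total_def renewal_count_arrival_time[of \<tau> x, OF assms] n)
    moreover have "0 \<le> arrival_time \<tau> n x"
      unfolding arrival_time_def using assms by (intro sum_nonneg) (simp add: less_imp_le)
    ultimately show "y \<in> ?A"
      using n by (auto intro!: exI[of _ "arrival_time \<tau> n x"])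
  qed
qed

text \<open>Arrival times and partial sums both increase with \<open>n\<close>, so the accepted
  indices form an initial segment and the series telescopes to a partial sum of sizes. Term
  \<open>n\<close> is purchase number \<open>n + 1\<close>, hence the \<open>Suc n\<close>.\<close>

lemma balance_sums:
  assumes \<xi>: "\<And>i. 0 \<le> \<xi> i x" and \<tau>: "\<And>i. 0 < \<tau> i x" and "0 \<le> t" "0 \<le> l"
  shows "(\<lambda>n. \<xi> n x * indicator {arrival_time \<tau> (Suc n) x..} t * indicator {\<Sum>i<Suc n. \<xi> i x..} l)
    sums balance \<xi> \<tau> l t x"
proof -
  let ?S = "\<lambda>n. \<Sum>i<n. \<xi> i x"
  let ?c = "\<lambda>n. arrival_time \<tau> n x \<le> t \<and> ?S n \<le> l"
  let ?a = "\<lambda>n. \<xi> n x * indicator {arrival_time \<tau> (Suc n) x..} t * indicator {?S (Suc n)..} l"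
  let ?C = "{?S n | n. ?c n}"
  have a: "?a n = (if ?c (Suc n) then \<xi> n x else 0)" for n
    by (auto split: split_indicator)
  have mono: "?S m \<le> ?S n" if "m \<le> n" for m n
    using that \<xi> by (intro sum_mono2) auto
  have down: "?c m" if "?c n" "m \<le> n" for m n
    using that mono[OF that(2)] arrival_time_le_iff[of \<tau> x, OF \<tau>, of m n] by linarith
  have c0: "?c 0" using assms by (simp add: arrival_time_def)
  \<comment> \<open>\<open>m\<close> is the last index up to \<open>n\<close> that satisfies
    \<open>?c\<close>; recording that \<open>Suc m\<close> fails when \<open>m < n\<close> is what
    lets the induction rule out a later acceptance.\<close>
  have partial: "\<exists>m\<le>n. ?c m \<and> (\<Sum>k<n. ?a k) = ?S m \<and> (m < n \<longrightarrow> \<not> ?c (Suc m))" for n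
  proof (induction n)
    case 0
    show ?case using c0 by auto
  next
    case (Suc n)
    then obtain m where m: "m \<le> n" "?c m" "(\<Sum>k<n. ?a k) = ?S m" "m < n \<Longrightarrow> \<not> ?c (Suc m)" by blast
    show ?case
    proof (cases "?c (Suc n)")
      case True
      then have "m = n" using m down[OF True, of "Suc m"] by (cases "m < n") auto
      with True m show ?thesis
        by (intro exI[of _ "Suc n"]) (auto simp: a simp del: sum.lessThan_Suc, simp_all)
    next
      case False
      with m show ?thesis
        by (intro exI[of _ m]) (auto simp: a less_Suc_eq_le le_less)
    qed
  qed
  have bal: "balance \<xi> \<tau> l t x = Sup ?C"
    unfolding balance_def attempted_totals_eq[of \<tau> x, OF \<tau>] ..
  \<comment> \<open>The partial sums run through exactly the set \<open>?C\<close>, so their limit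
    is its supremum, whether or not the supremum is attained.\<close>
  have "(\<lambda>n. \<Sum>k<n. ?a k) \<longlonglongrightarrow> (SUP n. \<Sum>k<n. ?a k)"
  proof (rule LIMSEQ_incseq_SUP)
    show "bdd_above (range (\<lambda>n. \<Sum>k<n. ?a k))"
    proof (rule bdd_aboveI[of _ l])
      fix y assume "y \<in> range (\<lambda>n. \<Sum>k<n. ?a k)"
      then obtain n where "y = (\<Sum>k<n. ?a k)" by blast
      moreover obtain m where "?c m" "(\<Sum>k<n. ?a k) = ?S m" using partial[of n] by blast
      ultimately show "y \<le> l" by (simp only:)
    qed
    show "incseq (\<lambda>n. \<Sum>k<n. ?a k)"
      using \<xi> by (intro incseq_SucI) simp
  qed
  also have "range (\<lambda>n. \<Sum>k<n. ?a k) = ?C"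
  proof
    show "range (\<lambda>n. \<Sum>k<n. ?a k) \<subseteq> ?C"
      using partial by blast
    show "?C \<subseteq> range (\<lambda>n. \<Sum>k<n. ?a k)"
    proof
      fix y assume "y \<in> ?C"
      then obtain n where n: "?c n" "y = ?S n" by auto
      have eq: "(\<Sum>k<n. ?a k) = ?S n"
        by (intro sum.cong refl) (use down[OF n(1)] in \<open>auto simp: a simp del: sum.lessThan_Suc\<close>)
      show "y \<in> range (\<lambda>n. \<Sum>k<n. ?a k)"
        by (rule image_eqI[where x = n]) (simp_all only: eq n UNIV_I)
    qed
  qed
  finally show ?thesis
    unfolding sums_def bal .
qed

lemma balance_le:
  assumes \<tau>: "\<And>i. 0 < \<tau> i x" and "0 \<le> t" "0 \<le> l"
  shows "0 \<le> balance \<xi> \<tau> l t x" and "balance \<xi> \<tau> l t x \<le> l"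
proof -
  let ?C = "{(\<Sum>i<n. \<xi> i x) | n. arrival_time \<tau> n x \<le> t \<and> (\<Sum>i<n. \<xi> i x) \<le> l}"
  have bal: "balance \<xi> \<tau> l t x = Sup ?C"
    unfolding balance_def attempted_totals_eq[of \<tau> x, OF \<tau>] ..
  have 0: "0 \<in> ?C" using assms by (auto simp: arrival_time_def intro!: exI[of _ 0])
  have "bdd_above ?C" by (auto intro!: bdd_aboveI[of _ l])
  with 0 show "0 \<le> balance \<xi> \<tau> l t x" unfolding bal by (rule cSup_upper)
  show "balance \<xi> \<tau> l t x \<le> l" unfolding bal by (rule cSup_least) (use 0 in auto)
qed

lemma balance_mono:
  assumes \<tau>: "\<And>i. 0 < \<tau> i x" and "0 \<le> t" "0 \<le> l" "l \<le> l'"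
  shows "balance \<xi> \<tau> l t x \<le> balance \<xi> \<tau> l' t x"
  unfolding balance_def attempted_totals_eq[of \<tau> x, OF \<tau>]
proof (rule cSup_subset_mono)
  show "{(\<Sum>i<n. \<xi> i x) | n. arrival_time \<tau> n x \<le> t \<and> (\<Sum>i<n. \<xi> i x) \<le> l} \<noteq> {}"
    using assms by (auto simp: arrival_time_def intro!: exI[of _ 0])
qed (use assms in \<open>auto intro!: bdd_aboveI[of _ l']\<close>)

section \<open>Stieltjes integrals against a distribution function as expectations\<close>

lemma interval_measure_cdf_distr:
  assumes "prob_space M" "Z \<in> borel_measurable M" and "cdf (distr M borel Z) = F"
  shows "interval_measure F = distr M borel Z"
proof -
  interpret D: real_distribution "distr M borel Z"
    using assms by (simp add: prob_space.real_distribution_distr)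
  have F: "real_distribution (interval_measure F)" "cdf (interval_measure F) = F"
    unfolding assms(3)[symmetric]
    by (auto intro!: real_distribution_interval_measure cdf_interval_measure D.cdf_nondecreasing
        D.cdf_is_right_cont D.cdf_lim_at_bot D.cdf_lim_at_top_prob)
  show ?thesis
    by (rule cdf_unique) (use F assms D.real_distribution_axioms in auto)
qed

text \<open>A nonnegative variable puts all its mass on the closed half-line, including any atom at
  0, so the restriction to \<open>{0..}\<close> costs nothing.\<close>

lemma laplace_stieltjes_eq:
  assumes "prob_space M" and [measurable]: "Z \<in> borel_measurable M" and "cdf (distr M borel Z) = F"
    and Z: "\<And>x. x \<in> space M \<Longrightarrow> 0 \<le> Z x"
  shows "laplace_stieltjes F \<theta> = (LINT x|M. exp (- \<theta> * of_real (Z x)))"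
proof -
  have "laplace_stieltjes F \<theta> = (LINT x|M. indicator {0..} (Z x) *\<^sub>R exp (- \<theta> * of_real (Z x)))"
    unfolding laplace_stieltjes_def interval_measure_cdf_distr[OF assms(1-3)] set_lebesgue_integral_def
    by (subst integral_distr) auto
  also have "\<dots> = (LINT x|M. exp (- \<theta> * of_real (Z x)))"
    using Z by (intro Bochner_Integration.integral_cong) auto
  finally show ?thesis .
qed

section \<open>Recovering arrival times from the counting process\<close>

lemma renewal_count_eqI:
  assumes \<tau>: "\<And>i. 0 < \<tau> i x" and "arrival_time \<tau> m x \<le> u" "u < arrival_time \<tau> (Suc m) x"
  shows "renewal_count \<tau> u x = m"
proof -
  have "arrival_time \<tau> k x \<le> u \<longleftrightarrow> k \<le> m" for k
    using arrival_time_le_iff[of \<tau> x k m, OF \<tau>] arrival_time_le_iff[of \<tau> x "Suc m" k, OF \<tau>] assms(2,3)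
    by linarith
  then have "{k. 1 \<le> k \<and> arrival_time \<tau> k x \<in> {0<..u}} = {1..m}"
    using arrival_time_pos[of \<tau> x, OF \<tau>] by auto
  then show ?thesis by (simp add: renewal_count_def)
qed

text \<open>On the null event of infinitely many arrivals before \<open>t\<close> the count at \<open>t\<close> is \<open>0\<close>, so
  \<open>n < renewal_count \<tau> t x\<close> is not equivalent to \<open>arrival_time \<tau> (Suc n) x \<le> t\<close>.\<close>

lemma arrival_time_le_iff_renewal_count:
  assumes \<tau>: "\<And>i. 0 < \<tau> i x"
  shows "arrival_time \<tau> (Suc n) x \<le> t \<longleftrightarrow>
    (\<exists>u \<in> insert t \<rat> \<inter> {0..t}. n < renewal_count \<tau> u x)"
proof
  assume le: "arrival_time \<tau> (Suc n) x \<le> t"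
  have pos: "0 < arrival_time \<tau> (Suc n) x"
    by (rule arrival_time_pos) (use \<tau> in auto)
  have lt: "arrival_time \<tau> (Suc n) x < arrival_time \<tau> (Suc (Suc n)) x"
    by (rule arrival_time_strict_mono) (use \<tau> in auto)
  show "\<exists>u \<in> insert t \<rat> \<inter> {0..t}. n < renewal_count \<tau> u x"
  \<comment> \<open>If the arrival falls exactly at \<open>t\<close>, then \<open>t\<close> is the
    only time up to \<open>t\<close> at which it has been counted; this is why \<open>t\<close>
    joins the rationals.\<close>
  proof (cases "arrival_time \<tau> (Suc n) x = t")
    case True
    then have "renewal_count \<tau> t x = Suc n"
      using lt by (intro renewal_count_eqI \<tau>) auto
    then show ?thesis
      using True pos by (intro bexI[of _ t]) auto
  next
    case False
    \<comment> \<open>A rational strictly between this arrival and the next one sees exactly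
      \<open>Suc n\<close> arrivals, whatever happens to the count at \<open>t\<close>.\<close>
    then have "arrival_time \<tau> (Suc n) x < min t (arrival_time \<tau> (Suc (Suc n)) x)"
      using le lt by simp
    from Rats_dense_in_real[OF this] obtain q where q: "q \<in> \<rat>"
      "arrival_time \<tau> (Suc n) x < q" "q < min t (arrival_time \<tau> (Suc (Suc n)) x)"
      by blast
    then have "renewal_count \<tau> q x = Suc n"
      by (intro renewal_count_eqI \<tau>) auto
    then show ?thesis
      using q pos by (intro bexI[of _ q]) auto
  qed
next
  assume "\<exists>u \<in> insert t \<rat> \<inter> {0..t}. n < renewal_count \<tau> u x"
  then obtain u where "0 \<le> u" "u \<le> t" "Suc n \<le> renewal_count \<tau> u x" by auto
  with arrival_time_le[of \<tau> x "Suc n" u, OF \<tau>] show "arrival_time \<tau> (Suc n) x \<le> t" by simp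
qed

section \<open>Independence of generated sigma-algebras and transforms of partial sums\<close>

lemma measurable_process_component:
  assumes "i \<in> I" and "\<And>j x. j \<in> I \<Longrightarrow> x \<in> S \<Longrightarrow> X j x \<in> space N"
  shows "X i \<in> vimage_algebra S (\<lambda>x. \<lambda>i\<in>I. X i x) (Pi\<^sub>M I (\<lambda>_. N)) \<rightarrow>\<^sub>M N"
proof -
  have "(\<lambda>x. (\<lambda>i\<in>I. X i x) i) \<in> vimage_algebra S (\<lambda>x. \<lambda>i\<in>I. X i x) (Pi\<^sub>M I (\<lambda>_. N)) \<rightarrow>\<^sub>M N"
    by (rule measurable_compose[OF measurable_vimage_algebra1 measurable_component_singleton])
       (use assms in \<open>auto simp: space_PiM\<close>)
  then show ?thesis using assms(1) by simp
qed

text \<open>Independence is inherited by the smaller sigma-algebras that \<open>X\<close> and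
  \<open>Y\<close> generate, which reduces the claim to the product rule for independent
  variables.\<close>

lemma (in prob_space) expectation_mult_indep_set:
  fixes X Y :: "'a \<Rightarrow> real"
  assumes "indep_set (sets A) (sets B)" "space A = space M" "space B = space M"
    and "X \<in> borel_measurable A" "Y \<in> borel_measurable B" "integrable M X" "integrable M Y"
  shows "expectation (\<lambda>x. X x * Y x) = expectation X * expectation Y"
proof (rule indep_var_lebesgue_integral)
  have sub: "sigma_sets (space M) {X -` S \<inter> space M |S. S \<in> sets borel} \<subseteq> sets C"
    if "space C = space M" "X \<in> borel_measurable C" for X :: "'a \<Rightarrow> real" and C
    unfolding that(1)[symmetric]
    by (rule sets.sigma_sets_subset) (auto intro: measurable_sets[OF that(2)])
  have "indep_set (sigma_sets (space M) {X -` S \<inter> space M |S. S \<in> sets borel})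
      (sigma_sets (space M) {Y -` S \<inter> space M |S. S \<in> sets borel})"
    using assms(1) sub[OF assms(2,4)] sub[OF assms(3,5)] unfolding indep_set_def
    by (elim indep_sets_mono_sets) (simp split: bool.split)
  then show "indep_var borel X borel Y"
    using borel_measurable_integrable[OF assms(6)] borel_measurable_integrable[OF assms(7)]
    unfolding indep_var_eq by simp
qed fact+

text \<open>The exponential of a sum is a product of independent factors. The weight
  \<open>X n\<close> affects only factor \<open>n\<close>, whose mean is then minus the derivative
  of the transform; the other \<open>n\<close> factors each give the transform itself.\<close>

lemma (in prob_space) laplace_partial_sum:
  fixes X :: "nat \<Rightarrow> 'a \<Rightarrow> real"
  assumes indep: "indep_vars (\<lambda>_. borel) X UNIV" and X: "\<And>i x. x \<in> space M \<Longrightarrow> 0 \<le> X i x"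
    and F: "\<And>i. cdf (distr M borel (X i)) = F" and "0 < Re \<theta>"
  shows "expectation (\<lambda>x. exp (- \<theta> * of_real (\<Sum>i<n. X i x))) = laplace_stieltjes F \<theta> ^ n"
    and "complex_integrable M (\<lambda>x. of_real (X n x) * exp (- \<theta> * of_real (\<Sum>i<Suc n. X i x)))"
    and "expectation (\<lambda>x. of_real (X n x) * exp (- \<theta> * of_real (\<Sum>i<Suc n. X i x)))
      = laplace_stieltjes F \<theta> ^ n * - deriv (laplace_stieltjes F) \<theta>"
proof -
  have rv[measurable]: "random_variable borel (X i)" for i
    using indep by (auto simp: indep_vars_def2)
  have L: "laplace_stieltjes F \<theta> = expectation (\<lambda>x. exp (- \<theta> * of_real (X i x)))" for i \<theta>
    by (rule laplace_stieltjes_eq) (auto intro: prob_space_axioms F X)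
  have "laplace_stieltjes F = (\<lambda>\<theta>. expectation (\<lambda>x. exp (- \<theta> * of_real (X n x))))"
    using L by auto
  then have D: "deriv (laplace_stieltjes F) \<theta> = - expectation (\<lambda>x. of_real (X n x) * exp (- \<theta> * of_real (X n x)))"
    using has_field_derivative_integral_exp[OF prob_space_axioms rv X, of \<theta> n] assms(4)
    by (auto intro: DERIV_imp_deriv)
  have i0: "complex_integrable M (\<lambda>x. exp (- \<theta> * of_real (X i x)))" for i
    using X assms(4) by (intro integrable_const_bound[where B = 1]) (auto intro!: AE_I2)
  have i1: "complex_integrable M (\<lambda>x. of_real (X n x) * exp (- \<theta> * of_real (X n x)))"
  proof (rule integrable_const_bound[where B = "2 / Re \<theta>"])
    show "AE x in M. norm (of_real (X n x) * exp (- \<theta> * of_real (X n x))) \<le> 2 / Re \<theta>"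
    proof (rule AE_I2)
      fix x assume x: "x \<in> space M"
      have "norm (of_real (X n x) * exp (- \<theta> * of_real (X n x))) = X n x * exp (- Re \<theta> * X n x)"
        using X[OF x] by (simp add: norm_mult)
      also have "\<dots> \<le> 2 / Re \<theta> * exp (- (Re \<theta> / 2) * X n x)"
        using assms(4) by (rule mult_exp_le)
      also have "\<dots> \<le> 2 / Re \<theta> * 1"
        using X[OF x] assms(4) by (intro mult_left_mono) auto
      finally show "norm (of_real (X n x) * exp (- \<theta> * of_real (X n x))) \<le> 2 / Re \<theta>" by simp
    qed
  qed measurable
  have ex: "exp (- \<theta> * complex_of_real (\<Sum>i<n. X i x)) = (\<Prod>i<n. exp (- \<theta> * of_real (X i x)))" for n x
    by (simp only: of_real_sum sum_distrib_left exp_sum[OF finite_lessThan])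
  have ind0: "indep_vars (\<lambda>_. borel) (\<lambda>i x. exp (- \<theta> * complex_of_real (X i x))) {..<n}" for n
    using indep_vars_compose2[OF indep_vars_subset[OF indep], of "{..<n}"
        "\<lambda>_ y. exp (- \<theta> * complex_of_real y)" "\<lambda>_. borel"] by simp
  show "expectation (\<lambda>x. exp (- \<theta> * of_real (\<Sum>i<n. X i x))) = laplace_stieltjes F \<theta> ^ n"
    unfolding ex
    by (subst indep_vars_lebesgue_integral[OF finite_lessThan ind0 i0])
       (simp only: L[symmetric] prod_constant card_lessThan)
  \<comment> \<open>Absorbing the weight into factor \<open>n\<close> keeps a single independent
    family, so the product rule applies once.\<close>
  let ?Y = "\<lambda>i x. (if i = n then of_real (X i x) else 1) * exp (- \<theta> * complex_of_real (X i x))"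
  have ex1: "of_real (X n x) * exp (- \<theta> * complex_of_real (\<Sum>i<Suc n. X i x)) = (\<Prod>i<Suc n. ?Y i x)" for x
  proof -
    have "(\<Prod>i<n. ?Y i x) = (\<Prod>i<n. exp (- \<theta> * complex_of_real (X i x)))"
      by (intro prod.cong) auto
    then show ?thesis
      unfolding ex by (simp add: prod.lessThan_Suc ac_simps)
  qed
  have ind1: "indep_vars (\<lambda>_. borel) ?Y {..<Suc n}"
    using indep_vars_compose2[OF indep_vars_subset[OF indep], of "{..<Suc n}"
        "\<lambda>i y. (if i = n then of_real y else 1) * exp (- \<theta> * complex_of_real y)" "\<lambda>_. borel"] by simp
  have iY: "complex_integrable M (?Y i)" for i
    using i0[of i] i1 by (cases "i = n") auto
  show "complex_integrable M (\<lambda>x. of_real (X n x) * exp (- \<theta> * of_real (\<Sum>i<Suc n. X i x)))"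
    unfolding ex1 by (rule indep_vars_integrable[OF _ ind1 iY]) auto
  have "expectation (\<lambda>x. of_real (X n x) * exp (- \<theta> * of_real (\<Sum>i<Suc n. X i x)))
      = (\<Prod>i<Suc n. expectation (?Y i))"
    unfolding ex1 by (rule indep_vars_lebesgue_integral[OF _ ind1 iY]) auto
  also have "\<dots> = (\<Prod>i<n. expectation (?Y i)) * expectation (?Y n)"
    by simp
  also have "(\<Prod>i<n. expectation (?Y i)) = (\<Prod>i<n. laplace_stieltjes F \<theta>)"
  proof (rule prod.cong[OF refl])
    fix i assume "i \<in> {..<n}"
    then have "?Y i = (\<lambda>x. exp (- \<theta> * complex_of_real (X i x)))" by auto
    then show "expectation (?Y i) = laplace_stieltjes F \<theta>" by (simp only: L[of \<theta> i])
  qed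
  also have "expectation (?Y n) = - deriv (laplace_stieltjes F) \<theta>"
    unfolding D by simp
  finally show "expectation (\<lambda>x. of_real (X n x) * exp (- \<theta> * of_real (\<Sum>i<Suc n. X i x)))
      = laplace_stieltjes F \<theta> ^ n * - deriv (laplace_stieltjes F) \<theta>" by simp
qed

section \<open>The mean balance\<close>

locale purchase_process = prob_space M for M :: "'a measure" +
  fixes \<xi> \<tau> :: "nat \<Rightarrow> 'a \<Rightarrow> real" and F G :: "real \<Rightarrow> real"
  assumes indep_\<xi>: "indep_vars (\<lambda>_. borel) \<xi> UNIV"
    and indep_\<tau>: "indep_vars (\<lambda>_. borel) \<tau> UNIV"
    and indep_\<xi>_count: "indep_set (process_events M UNIV borel \<xi>)
          (process_events M {0..} (count_space UNIV) (renewal_count \<tau>))"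
    and \<xi>_nonneg: "\<And>i x. x \<in> space M \<Longrightarrow> 0 \<le> \<xi> i x"
    and \<tau>_pos: "\<And>i x. x \<in> space M \<Longrightarrow> 0 < \<tau> i x"
    and cdf_\<xi>: "\<And>i. cdf (distr M borel (\<xi> i)) = F"
    and cdf_\<tau>: "\<And>i. cdf (distr M borel (\<tau> i)) = G"
begin

abbreviation "mean_balance l t \<equiv> expectation (balance \<xi> \<tau> l t)"

text \<open>This function of \<open>t\<close> and \<open>accepted_mean\<close>, a function of
  \<open>l\<close>, are the two factors of the mean of one term. The separation of variables yields
  joint measurability in \<open>(t, l)\<close> and lets each double integral split into a
  product.\<close>

definition arrival_prob :: "nat \<Rightarrow> real \<Rightarrow> real" where
  "arrival_prob n t = expectation (indicator {x. arrival_time \<tau> (Suc n) x \<le> t})"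

definition accepted_mean :: "nat \<Rightarrow> real \<Rightarrow> real" where
  "accepted_mean n l = expectation (\<lambda>x. \<xi> n x * indicator {\<Sum>i<Suc n. \<xi> i x..} l)"

lemma rv_\<xi> [measurable]: "random_variable borel (\<xi> i)"
  using indep_\<xi> by (auto simp: indep_vars_def2)

lemma rv_\<tau> [measurable]: "random_variable borel (\<tau> i)"
  using indep_\<tau> by (auto simp: indep_vars_def2)

lemma rv_arrival_time [measurable]: "random_variable borel (arrival_time \<tau> n)"
  unfolding arrival_time_def by measurable

lemma arrival_time_nonneg: "x \<in> space M \<Longrightarrow> 0 \<le> arrival_time \<tau> n x"
  unfolding arrival_time_def by (intro sum_nonneg) (simp add: \<tau>_pos less_imp_le)

lemma sum_\<xi>_nonneg: "x \<in> space M \<Longrightarrow> 0 \<le> (\<Sum>i<n. \<xi> i x)"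
  by (intro sum_nonneg) (simp add: \<xi>_nonneg)

text \<open>A single nonnegative summand is at most the whole sum, which is at most \<open>l\<close>
  where the indicator is 1. The constant \<open>l\<close> thus bounds every accepted size.\<close>

lemma accepted_le:
  assumes "x \<in> space M" "0 \<le> l"
  shows "\<xi> n x * indicator {\<Sum>i<Suc n. \<xi> i x..} l \<le> l"
  using assms sum_\<xi>_nonneg[OF assms(1), of n] by (auto split: split_indicator)

lemma integrable_accepted: "0 \<le> l \<Longrightarrow> integrable M (\<lambda>x. \<xi> n x * indicator {\<Sum>i<Suc n. \<xi> i x..} l)"
  using accepted_le \<xi>_nonneg
  by (intro integrable_const_bound[where B = l]) (auto intro!: AE_I2 simp: indicator_def[of "{_..}"])

text \<open>Bridges the gap to the independence assumption, which concerns the counts at nonnegative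
  times: the event is a countable union of events about counts.\<close>

lemma arrival_event:
  "{x \<in> space M. arrival_time \<tau> (Suc n) x \<le> t}
    \<in> process_events M {0..} (count_space UNIV) (renewal_count \<tau>)"
proof -
  let ?V = "vimage_algebra (space M) (\<lambda>x. \<lambda>i\<in>{0..}. renewal_count \<tau> i x) (Pi\<^sub>M {0..} (\<lambda>_. count_space UNIV))"
  have ev: "{x \<in> space M. n < renewal_count \<tau> u x} \<in> sets ?V" if "0 \<le> u" for u
  proof -
    have "renewal_count \<tau> u \<in> ?V \<rightarrow>\<^sub>M count_space UNIV"
      by (rule measurable_process_component) (use that in auto)
    from measurable_sets[OF this, of "{n<..}"] show ?thesis
      by (simp add: vimage_def Collect_conj_eq Int_commute)
  qed
  have "{x \<in> space M. arrival_time \<tau> (Suc n) x \<le> t}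
      = (\<Union>u \<in> insert t \<rat> \<inter> {0..t}. {x \<in> space M. n < renewal_count \<tau> u x})"
    using arrival_time_le_iff_renewal_count[of \<tau> _ n t] \<tau>_pos by auto
  also have "\<dots> \<in> sets ?V"
    by (rule sets.countable_UN'') (auto intro: ev countable_rat countable_Int1)
  finally show ?thesis unfolding process_events_def .
qed

lemma expectation_accepted_arrived:
  assumes "0 \<le> l"
  shows "expectation (\<lambda>x. \<xi> n x * indicator {arrival_time \<tau> (Suc n) x..} t * indicator {\<Sum>i<Suc n. \<xi> i x..} l)
    = arrival_prob n t * accepted_mean n l"
proof -
  let ?A = "vimage_algebra (space M) (\<lambda>x. \<lambda>i\<in>UNIV. \<xi> i x) (Pi\<^sub>M UNIV (\<lambda>_. borel :: real measure))"
  let ?B = "vimage_algebra (space M) (\<lambda>x. \<lambda>i\<in>{0..}. renewal_count \<tau> i x) (Pi\<^sub>M {0..} (\<lambda>_. count_space UNIV))"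
  let ?E = "{x \<in> space M. arrival_time \<tau> (Suc n) x \<le> t}"
  have [measurable]: "\<xi> i \<in> borel_measurable ?A" for i
    by (rule measurable_process_component) auto
  have [measurable]: "?E \<in> sets ?B"
    using arrival_event unfolding process_events_def .
  have "expectation (\<lambda>x. \<xi> n x * indicator {arrival_time \<tau> (Suc n) x..} t * indicator {\<Sum>i<Suc n. \<xi> i x..} l)
      = expectation (\<lambda>x. (\<xi> n x * indicator {\<Sum>i<Suc n. \<xi> i x..} l) * indicator ?E x)"
    by (intro Bochner_Integration.integral_cong) (auto split: split_indicator)
  also have "\<dots> = accepted_mean n l * expectation (indicator ?E)"
    unfolding accepted_mean_def
  proof (rule expectation_mult_indep_set[where A = ?A and B = ?B])
    show "indep_set (sets ?A) (sets ?B)"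
      using indep_\<xi>_count unfolding process_events_def .
    show "(\<lambda>x. \<xi> n x * indicator {\<Sum>i<Suc n. \<xi> i x..} l) \<in> borel_measurable ?A"
      unfolding indicator_def atLeast_iff of_bool_def by measurable
    show "integrable M (\<lambda>x. \<xi> n x * indicator {\<Sum>i<Suc n. \<xi> i x..} l)"
      by (rule integrable_accepted) fact
    show "integrable M (indicator ?E :: _ \<Rightarrow> real)"
      by (intro integrable_real_indicator) (auto simp: less_top[symmetric])
  qed auto
  also have "expectation (indicator ?E) = arrival_prob n t"
    unfolding arrival_prob_def by (intro Bochner_Integration.integral_cong) (auto split: split_indicator)
  finally show ?thesis by simp
qed

text \<open>\<open>balance\<close> is a supremum over uncountably many times; the series provides a
  countable description.\<close>

lemma rv_balance:
  assumes "0 \<le> l" "0 \<le> t"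
  shows "random_variable borel (balance \<xi> \<tau> l t)"
proof -
  have eq: "balance \<xi> \<tau> l t x
      = (\<Sum>n. \<xi> n x * indicator {arrival_time \<tau> (Suc n) x..} t * indicator {\<Sum>i<Suc n. \<xi> i x..} l)"
    if "x \<in> space M" for x
    by (rule sums_unique[OF balance_sums]) (use that assms \<xi>_nonneg \<tau>_pos in auto)
  show ?thesis
    by (subst measurable_cong[OF eq]) (simp_all add: indicator_def of_bool_def)
qed

lemma integrable_balance:
  assumes "0 \<le> l" "0 \<le> t"
  shows "integrable M (balance \<xi> \<tau> l t)"
  using rv_balance[OF assms] balance_le[of \<tau> _ t l \<xi>] \<tau>_pos assms
  by (intro integrable_const_bound[where B = l]) (auto intro!: AE_I2)

lemma mean_balance_nonneg: "0 \<le> l \<Longrightarrow> 0 \<le> t \<Longrightarrow> 0 \<le> mean_balance l t"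
  using balance_le(1)[of \<tau> _ t l \<xi>] \<tau>_pos by (intro Bochner_Integration.integral_nonneg_AE AE_I2) auto

lemma mean_balance_le: "0 \<le> l \<Longrightarrow> 0 \<le> t \<Longrightarrow> mean_balance l t \<le> l"
  using balance_le(2)[of \<tau> _ t l \<xi>] \<tau>_pos by (intro integral_le_const integrable_balance AE_I2) auto

lemma mean_balance_mono: "0 \<le> l \<Longrightarrow> l \<le> l' \<Longrightarrow> 0 \<le> t \<Longrightarrow> mean_balance l t \<le> mean_balance l' t"
  using balance_mono[of \<tau> _ t l l' \<xi>] \<tau>_pos by (intro integral_mono integrable_balance) auto

text \<open>Dominated convergence: the terms are nonnegative, so the partial sums stay below the
  balance and hence below the constant \<open>l\<close>.\<close>

lemma mean_balance_sums:
  assumes l: "0 \<le> l" and t: "0 \<le> t"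
  shows "(\<lambda>n. arrival_prob n t * accepted_mean n l) sums mean_balance l t"
proof -
  let ?h = "\<lambda>n x. \<xi> n x * indicator {arrival_time \<tau> (Suc n) x..} t * indicator {\<Sum>i<Suc n. \<xi> i x..} l"
  have sums: "(\<lambda>n. ?h n x) sums balance \<xi> \<tau> l t x" if "x \<in> space M" for x
    by (rule balance_sums) (use that assms \<xi>_nonneg \<tau>_pos in auto)
  have h0: "0 \<le> ?h n x" if "x \<in> space M" for n x
    using \<xi>_nonneg[OF that] by simp
  have int: "integrable M (?h n)" for n
  proof (rule integrable_const_bound[where B = l])
    show "AE x in M. norm (?h n x) \<le> l"
    proof (rule AE_I2)
      fix x assume x: "x \<in> space M"
      show "norm (?h n x) \<le> l"
        using accepted_le[OF x l, of n] \<xi>_nonneg[OF x, of n] l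
        by (auto split: split_indicator split_indicator_asm)
    qed
    show "random_variable borel (?h n)"
      unfolding indicator_def atLeast_iff of_bool_def by measurable
  qed
  have "(\<lambda>n. expectation (\<lambda>x. \<Sum>k<n. ?h k x)) \<longlonglongrightarrow> mean_balance l t"
  proof (rule integral_dominated_convergence[where w = "\<lambda>_. l"])
    show "AE x in M. (\<lambda>n. \<Sum>k<n. ?h k x) \<longlonglongrightarrow> balance \<xi> \<tau> l t x"
      using sums by (auto simp: sums_def)
    show "AE x in M. norm (\<Sum>k<n. ?h k x) \<le> l" for n
    proof (rule AE_I2)
      fix x assume x: "x \<in> space M"
      have "(\<Sum>k<n. ?h k x) \<le> (\<Sum>k. ?h k x)"
        using sums[OF x] h0[OF x] by (intro sum_le_suminf) (auto simp: sums_iff)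
      also have "\<dots> = balance \<xi> \<tau> l t x"
        using sums[OF x] by (simp add: sums_iff)
      also have "\<dots> \<le> l"
        by (rule balance_le) (use x \<tau>_pos l t in auto)
      finally show "norm (\<Sum>k<n. ?h k x) \<le> l"
        using sum_nonneg[of "{..<n}" "\<lambda>k. ?h k x"] h0[OF x] by simp
    qed
    show "(\<lambda>x. \<Sum>k<n. ?h k x) \<in> borel_measurable M" for n
      using int by (intro borel_measurable_sum borel_measurable_integrable)
  qed (use rv_balance l t in auto)
  moreover have "expectation (\<lambda>x. \<Sum>k<n. ?h k x) = (\<Sum>k<n. arrival_prob k t * accepted_mean k l)" for n
    by (simp only: Bochner_Integration.integral_sum[OF int] expectation_accepted_arrived[OF l])
  ultimately show ?thesis by (simp add: sums_def)
qed

section \<open>Transforms of the two factors of each term\<close>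

lemma measurable_arrival_prob [measurable]: "arrival_prob n \<in> borel_measurable borel"
  unfolding arrival_prob_def indicator_def mem_Collect_eq of_bool_def by measurable

lemma measurable_accepted_mean [measurable]: "accepted_mean n \<in> borel_measurable borel"
  unfolding accepted_mean_def indicator_def atLeast_iff of_bool_def by measurable

lemma arrival_prob_nonneg: "0 \<le> arrival_prob n t"
  unfolding arrival_prob_def by simp

lemma accepted_mean_nonneg: "0 \<le> accepted_mean n l"
  unfolding accepted_mean_def using \<xi>_nonneg by (intro Bochner_Integration.integral_nonneg_AE AE_I2) simp

lemma laplace_arrival_prob:
  assumes "0 < Re \<omega>"
  shows "(LINT t:{0<..}|lborel. exp (- \<omega> * of_real t) * of_real (arrival_prob n t)) = laplace_stieltjes G \<omega> ^ Suc n / \<omega>"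
proof -
  \<comment> \<open>The factor 1 is the weight \<open>W\<close> in
    \<open>laplace_cumulative\<close>.\<close>
  have ap: "arrival_prob n t = (LINT x|M. 1 * indicator {arrival_time \<tau> (Suc n) x..} t)" for t
    unfolding arrival_prob_def by (intro Bochner_Integration.integral_cong) (auto split: split_indicator)
  have "(LINT t:{0<..}|lborel. exp (- \<omega> * of_real t) * of_real (arrival_prob n t))
      = (LINT x|M. of_real 1 * exp (- \<omega> * of_real (arrival_time \<tau> (Suc n) x))) / \<omega>"
    unfolding ap
  proof (rule laplace_cumulative)
    show "integrable M (\<lambda>x. 1 * exp (- Re \<omega> * arrival_time \<tau> (Suc n) x))"
      using assms arrival_time_nonneg
      by (intro integrable_const_bound[where B = 1]) (auto intro!: AE_I2)
  qed (use assms arrival_time_nonneg in auto)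
  also have "(LINT x|M. of_real 1 * exp (- \<omega> * of_real (arrival_time \<tau> (Suc n) x))) = laplace_stieltjes G \<omega> ^ Suc n"
    using laplace_partial_sum(1)[OF indep_\<tau> _ cdf_\<tau> assms, of "Suc n"] \<tau>_pos
    unfolding arrival_time_def by (simp add: less_imp_le)
  finally show ?thesis .
qed

lemma laplace_accepted_mean:
  assumes "0 < Re \<theta>"
  shows "(LINT l:{0<..}|lborel. exp (- \<theta> * of_real l) * of_real (accepted_mean n l))
    = laplace_stieltjes F \<theta> ^ n * - deriv (laplace_stieltjes F) \<theta> / \<theta>"
proof -
  have "(LINT l:{0<..}|lborel. exp (- \<theta> * of_real l) * of_real (accepted_mean n l))
      = (LINT x|M. of_real (\<xi> n x) * exp (- \<theta> * of_real (\<Sum>i<Suc n. \<xi> i x))) / \<theta>"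
    unfolding accepted_mean_def
  proof (rule laplace_cumulative)
    have "complex_integrable M (\<lambda>x. of_real (\<xi> n x) * exp (- \<theta> * of_real (\<Sum>i<Suc n. \<xi> i x)))"
      using \<xi>_nonneg assms by (intro laplace_partial_sum(2)[OF indep_\<xi> _ cdf_\<xi>])
    then have "integrable M (\<lambda>x. norm (of_real (\<xi> n x) * exp (- \<theta> * of_real (\<Sum>i<Suc n. \<xi> i x))))"
      by (rule integrable_norm)
    then show "integrable M (\<lambda>x. \<xi> n x * exp (- Re \<theta> * (\<Sum>i<Suc n. \<xi> i x)))"
      by (rule Bochner_Integration.integrable_cong[THEN iffD1, rotated 2]) (auto simp: norm_mult \<xi>_nonneg)
  qed (use assms in \<open>auto simp: sum_\<xi>_nonneg \<xi>_nonneg\<close>)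
  also have "(LINT x|M. of_real (\<xi> n x) * exp (- \<theta> * of_real (\<Sum>i<Suc n. \<xi> i x)))
      = laplace_stieltjes F \<theta> ^ n * - deriv (laplace_stieltjes F) \<theta>"
    using \<xi>_nonneg assms by (intro laplace_partial_sum(3)[OF indep_\<xi> _ cdf_\<xi>])
  finally show ?thesis .
qed

lemma norm_laplace_F_le_1:
  assumes "0 < Re \<theta>"
  shows "norm (laplace_stieltjes F \<theta>) \<le> 1"
proof -
  have "laplace_stieltjes F \<theta> = expectation (\<lambda>x. exp (- \<theta> * of_real (\<xi> 0 x)))"
    by (rule laplace_stieltjes_eq) (auto intro: prob_space_axioms cdf_\<xi> \<xi>_nonneg)
  also have "norm \<dots> \<le> expectation (\<lambda>x. norm (exp (- \<theta> * of_real (\<xi> 0 x))))"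
    by (rule integral_norm_bound)
  also have "\<dots> \<le> 1"
    using assms \<xi>_nonneg by (intro integral_le_const integrable_const_bound[where B = 1] AE_I2) auto
  finally show ?thesis .
qed

text \<open>Strictness comes from positive gaps, which make the integrand smaller than 1 everywhere.
  Purchases may be 0, so for \<open>F\<close> only the weak bound is available; the product of the
  two transforms is still below 1 in norm.\<close>

lemma norm_laplace_G_less_1:
  assumes "0 < Re \<omega>"
  shows "norm (laplace_stieltjes G \<omega>) < 1"
proof -
  have "laplace_stieltjes G \<omega> = expectation (\<lambda>x. exp (- \<omega> * of_real (\<tau> 0 x)))"
    by (rule laplace_stieltjes_eq) (auto intro: prob_space_axioms cdf_\<tau> \<tau>_pos less_imp_le)
  also have "norm \<dots> \<le> expectation (\<lambda>x. norm (exp (- \<omega> * of_real (\<tau> 0 x))))"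
    by (rule integral_norm_bound)
  also have "\<dots> < expectation (\<lambda>_. 1)"
    using assms \<tau>_pos
    by (intro integral_less_AE_space integrable_const_bound[where B = 1] AE_I2)
       (auto simp: emeasure_space_1 less_imp_le)
  also have "\<dots> = 1" by (simp add: prob_space)
  finally show ?thesis .
qed

text \<open>The series is integrated termwise over the quadrant in the product measure, where each
  term factors; integrability of the limit is proved first and then dominates the terms.\<close>

lemma double_laplace_mean_balance:
  fixes \<theta> \<omega> :: complex
  assumes \<theta>: "0 < Re \<theta>" and \<omega>: "0 < Re \<omega>"
  shows "set_integrable (lborel \<Otimes>\<^sub>M lborel) ({0<..} \<times> {0<..})
      (\<lambda>(t, l). exp (- (\<omega> * of_real t + \<theta> * of_real l)) * of_real (mean_balance l t))" (is ?int)
    and "(LINT t:{0<..}|lborel. LINT l:{0<..}|lborel.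
        exp (- (\<omega> * of_real t + \<theta> * of_real l)) * of_real (mean_balance l t))
      = - (laplace_stieltjes G \<omega> / (\<theta> * \<omega> * (1 - laplace_stieltjes G \<omega> * laplace_stieltjes F \<theta>)))
          * deriv (laplace_stieltjes F) \<theta>" (is ?eq)
proof -
  define c d where "c = Re \<omega>" and "d = Re \<theta>"
  have cd: "0 < c" "0 < d" using assms by (auto simp: c_def d_def)
  let ?P = "lborel \<Otimes>\<^sub>M (lborel :: real measure)"
  let ?Q = "{0<..} \<times> {0<..} :: (real \<times> real) set"
  let ?K = "\<lambda>t l. exp (- (\<omega> * complex_of_real t + \<theta> * complex_of_real l))"
  \<comment> \<open>The indicators and exponentials are distributed over the two variables so that
    the iterated integral of \<open>h n\<close> splits into two single transforms.\<close>
  define h :: "nat \<Rightarrow> real \<times> real \<Rightarrow> complex" where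
    "h n p = (case p of (t, l) \<Rightarrow> indicator {0<..} t *\<^sub>R (exp (- \<omega> * of_real t) * of_real (arrival_prob n t))
      * indicator {0<..} l *\<^sub>R (exp (- \<theta> * of_real l) * of_real (accepted_mean n l)))" for n p
  define H :: "real \<times> real \<Rightarrow> complex" where
    "H p = indicator ?Q p *\<^sub>R (case p of (t, l) \<Rightarrow> ?K t l * of_real (mean_balance l t))" for p
  have norm_h: "norm (h n (t, l)) = indicator ?Q (t, l) * (exp (- c * t) * exp (- d * l)
      * (arrival_prob n t * accepted_mean n l))" for n t l
    using arrival_prob_nonneg[of n t] accepted_mean_nonneg[of n l]
    by (simp add: h_def norm_mult c_def d_def indicator_times split: split_indicator)
  have norm_H: "norm (H (t, l)) = indicator ?Q (t, l) * (exp (- c * t) * exp (- d * l) * mean_balance l t)" for t l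
    using mean_balance_nonneg[of l t] unfolding H_def prod.case
    by (simp add: norm_mult c_def d_def exp_add[symmetric] split: split_indicator)
  have sums_H: "(\<lambda>n. h n p) sums H p" for p
  proof (cases "p \<in> ?Q")
    case True
    then obtain t l where p: "p = (t, l)" "0 < t" "0 < l" by auto
    have "(\<lambda>n. ?K t l * of_real (arrival_prob n t * accepted_mean n l)) sums (?K t l * of_real (mean_balance l t))"
      using mean_balance_sums[of l t] p by (intro sums_mult sums_of_real) auto
    moreover have "?K t l * of_real (arrival_prob n t * accepted_mean n l) = h n p" for n
      using p by (simp add: h_def exp_diff exp_minus exp_add field_simps)
    ultimately show ?thesis
      using p by (simp add: H_def)
  qed (auto simp: h_def H_def indicator_times split: prod.split split_indicator)
  \<comment> \<open>All terms share the same kernel, and the remaining factors are nonnegative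
    reals, so no cancellation occurs. This yields both the integrability of each \<open>h n\<close>
    and the summability of the integrated norms.\<close>
  have sums_norm: "(\<lambda>n. norm (h n p)) sums norm (H p)" for p
  proof (cases "p \<in> ?Q")
    case True
    then obtain t l where p: "p = (t, l)" "0 < t" "0 < l" by auto
    show ?thesis
      unfolding p(1) norm_h norm_H using mean_balance_sums[of l t] p by (intro sums_mult) auto
  qed (cases p, simp add: norm_h norm_H)
  have h_meas [measurable]: "h n \<in> borel_measurable ?P" for n
    unfolding h_def by measurable
  have H_meas: "H \<in> borel_measurable ?P"
    by (rule borel_measurable_LIMSEQ_metric[where f = "\<lambda>n p. \<Sum>k<n. h k p"])
       (use sums_H in \<open>auto simp: sums_def\<close>)
  have int_H: "integrable ?P H"
  proof (rule Bochner_Integration.integrable_bound)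
    \<comment> \<open>The bound of the mean balance by \<open>l\<close> gives a majorant in product
      form, so its double integral is a product of two finite integrals.\<close>
    let ?B = "\<lambda>p. case p of (t, l) \<Rightarrow> (indicator {0<..} t * exp (- c * t)) * (indicator {0<..} l * (l * exp (- d * l)))"
    show "integrable ?P ?B"
    proof (rule integrableI_bounded)
      have "(\<integral>\<^sup>+p. ennreal (norm (?B p)) \<partial>?P)
          = (\<integral>\<^sup>+t. \<integral>\<^sup>+l. ennreal (norm (?B (t, l))) \<partial>lborel \<partial>lborel)"
        by (subst lborel.nn_integral_fst[symmetric]) (auto simp: split_beta')
      also have "\<dots> = (\<integral>\<^sup>+t. \<integral>\<^sup>+l. ennreal (norm (indicator {0<..} t * exp (- c * t)))
          * ennreal (norm (indicator {0<..} l * (l * exp (- d * l)))) \<partial>lborel \<partial>lborel)"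
        by (intro nn_integral_cong) (simp add: abs_mult ennreal_mult'[symmetric])
      also have "\<dots> = (\<integral>\<^sup>+t. ennreal (norm (indicator {0<..} t * exp (- c * t))) \<partial>lborel)
          * (\<integral>\<^sup>+l. ennreal (norm (indicator {0<..} l * (l * exp (- d * l)))) \<partial>lborel)"
        by (subst nn_integral_cmult, measurable, subst nn_integral_multc) auto
      also have "\<dots> < \<infinity>"
      proof -
        have "set_integrable lborel {0<..} (\<lambda>t. norm (exp (- complex_of_real c * of_real t)))"
          using integrable_exp_kernel[of "complex_of_real c"] cd by (intro set_integrable_norm) simp
        then show ?thesis
          using set_integrable_linear_mult_exp[OF cd(2)]
          unfolding set_integrable_def integrable_iff_bounded by (simp add: ennreal_mult_less_top less_top)
      qed
      finally show "(\<integral>\<^sup>+p. ennreal (norm (?B p)) \<partial>?P) < \<infinity>" .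
    qed measurable
    show "AE p in ?P. norm (H p) \<le> norm (?B p)"
    proof (rule AE_I2)
      fix p :: "real \<times> real"
      obtain t l where p: "p = (t, l)" by force
      have "exp (- c * t) * exp (- d * l) * mean_balance l t \<le> exp (- c * t) * exp (- d * l) * l" if "0 < t" "0 < l"
        using mean_balance_le[of l t] that by (intro mult_left_mono) auto
      then show "norm (H p) \<le> norm (?B p)"
        unfolding p norm_H by (auto simp: indicator_times abs_mult ac_simps split: split_indicator)
    qed
  qed (rule H_meas)
  show ?int
    using int_H unfolding H_def set_integrable_def .
  have int_h: "integrable ?P (h n)" for n
  proof (rule Bochner_Integration.integrable_bound[OF int_H h_meas])
    show "AE p in ?P. norm (h n p) \<le> norm (H p)"
      using sum_le_suminf[OF sums_summable[OF sums_norm], of "{n}"] sums_norm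
      by (auto simp: sums_iff)
  qed
  have "(\<lambda>n. integral\<^sup>L ?P (h n)) sums (LINT p|?P. (\<Sum>n. h n p))"
  proof (rule sums_integral[OF int_h])
    show "AE p in ?P. summable (\<lambda>n. norm (h n p))"
      using sums_norm by (auto simp: sums_iff)
    show "summable (\<lambda>n. LINT p|?P. norm (h n p))"
    proof (rule summableI_nonneg_bounded[where x = "LINT p|?P. norm (H p)"])
      fix n
      have "(\<Sum>k<n. LINT p|?P. norm (h k p)) = (LINT p|?P. (\<Sum>k<n. norm (h k p)))"
        by (rule Bochner_Integration.integral_sum[symmetric]) (rule integrable_norm[OF int_h])
      also have "\<dots> \<le> (LINT p|?P. norm (H p))"
      proof (rule integral_mono)
        show "(\<Sum>k<n. norm (h k p)) \<le> norm (H p)" for p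
          using sum_le_suminf[OF sums_summable[OF sums_norm], of "{..<n}" p] sums_norm[of p] by (simp add: sums_iff)
      qed (intro Bochner_Integration.integrable_sum integrable_norm int_h int_H)+
      finally show "(\<Sum>k<n. LINT p|?P. norm (h k p)) \<le> (LINT p|?P. norm (H p))" .
    qed simp
  qed
  moreover have "(\<Sum>n. h n p) = H p" for p
    using sums_H by (simp add: sums_iff)
  \<comment> \<open>The arrival factor carries the power \<open>Suc n\<close> of the transform of
    \<open>G\<close>, the size factor only the power \<open>n\<close> of that of \<open>F\<close>;
    the spare factor moves into the constant of the geometric series.\<close>
  moreover have "integral\<^sup>L ?P (h n) = (laplace_stieltjes G \<omega> * laplace_stieltjes F \<theta>) ^ n *
      - (laplace_stieltjes G \<omega> / (\<theta> * \<omega>) * deriv (laplace_stieltjes F) \<theta>)" for n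
  proof -
    have "integral\<^sup>L ?P (h n) = (LINT t|lborel. LINT l|lborel. h n (t, l))"
      by (rule lborel_pair.integral_fst'[OF int_h, symmetric])
    also have "\<dots> = (LINT t:{0<..}|lborel. exp (- \<omega> * of_real t) * of_real (arrival_prob n t))
        * (LINT l:{0<..}|lborel. exp (- \<theta> * of_real l) * of_real (accepted_mean n l))"
      unfolding h_def prod.case set_lebesgue_integral_def
      by (subst integral_mult_right_zero, subst integral_mult_left_zero) (rule refl)
    also have "\<dots> = (laplace_stieltjes G \<omega> * laplace_stieltjes F \<theta>) ^ n *
      - (laplace_stieltjes G \<omega> / (\<theta> * \<omega>) * deriv (laplace_stieltjes F) \<theta>)"
      unfolding laplace_arrival_prob[OF \<omega>] laplace_accepted_mean[OF \<theta>] by (simp add: power_mult_distrib mult.commute mult.left_commute)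
    finally show ?thesis .
  qed
  moreover have "(\<lambda>n. (laplace_stieltjes G \<omega> * laplace_stieltjes F \<theta>) ^ n *
      - (laplace_stieltjes G \<omega> / (\<theta> * \<omega>) * deriv (laplace_stieltjes F) \<theta>))
    sums (1 / (1 - laplace_stieltjes G \<omega> * laplace_stieltjes F \<theta>) *
      - (laplace_stieltjes G \<omega> / (\<theta> * \<omega>) * deriv (laplace_stieltjes F) \<theta>))"
  proof (intro sums_mult2 geometric_sums)
    have "norm (laplace_stieltjes G \<omega>) * norm (laplace_stieltjes F \<theta>) \<le> norm (laplace_stieltjes G \<omega>) * 1"
      by (intro mult_left_mono norm_laplace_F_le_1 \<theta>) simp
    then show "norm (laplace_stieltjes G \<omega> * laplace_stieltjes F \<theta>) < 1"
      using norm_laplace_G_less_1[OF \<omega>] by (simp add: norm_mult)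
  qed
  ultimately have "integral\<^sup>L ?P H = 1 / (1 - laplace_stieltjes G \<omega> * laplace_stieltjes F \<theta>) *
      - (laplace_stieltjes G \<omega> / (\<theta> * \<omega>) * deriv (laplace_stieltjes F) \<theta>)"
    by (simp only: sums_unique2)
  then show ?eq
    unfolding set_integral_times_fst[OF \<open>?int\<close>] unfolding set_lebesgue_integral_def H_def by simp
qed

text \<open>For fixed \<open>t\<close> the identity is \<open>laplace_derivative\<close>. The
  remaining work is joint integrability: at real parameters the same identity evaluates the inner
  integral of the norm as a multiple of the one for the mean balance, whose integrability in
  \<open>t\<close> is already known.\<close>

lemma double_laplace_deriv_mean_balance:
  fixes \<theta> \<omega> :: complex
  assumes \<theta>: "0 < Re \<theta>" and \<omega>: "0 < Re \<omega>"
    and diff: "\<And>l t. 0 < l \<Longrightarrow> 0 < t \<Longrightarrow> (\<lambda>l. mean_balance l t) differentiable (at l)"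
  shows "set_integrable (lborel \<Otimes>\<^sub>M lborel) ({0<..} \<times> {0<..})
      (\<lambda>(t, l). exp (- (\<omega> * of_real t + \<theta> * of_real l)) * of_real (deriv (\<lambda>l. mean_balance l t) l))" (is ?int)
    and "(LINT t:{0<..}|lborel. LINT l:{0<..}|lborel.
        exp (- (\<omega> * of_real t + \<theta> * of_real l)) * of_real (deriv (\<lambda>l. mean_balance l t) l))
      = \<theta> * (LINT t:{0<..}|lborel. LINT l:{0<..}|lborel.
        exp (- (\<omega> * of_real t + \<theta> * of_real l)) * of_real (mean_balance l t))" (is ?eq)
proof -
  define c d where "c = Re \<omega>" and "d = Re \<theta>"
  have cd: "0 < c" "0 < d" using assms by (auto simp: c_def d_def)
  let ?P = "lborel \<Otimes>\<^sub>M (lborel :: real measure)"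
  let ?Q = "{0<..} \<times> {0<..} :: (real \<times> real) set"
  let ?D = "\<lambda>t l. deriv (\<lambda>l. mean_balance l t) l"
  \<comment> \<open>The parameters are kept as arguments because the kernel is needed both at
    \<open>\<omega>\<close>, \<open>\<theta>\<close> and at their real parts \<open>c\<close>,
    \<open>d\<close>.\<close>
  let ?K = "\<lambda>\<omega> \<theta> t l. exp (- (\<omega> * complex_of_real t + \<theta> * complex_of_real l))"
  have K: "?K \<omega> \<theta> t l = exp (- \<omega> * of_real t) * exp (- \<theta> * of_real l)" for \<omega> \<theta> t l
    by (simp add: exp_diff exp_minus exp_add field_simps)
  have LK: "(LINT l:{0<..}|lborel. ?K \<omega> \<theta> t l * of_real (f l))
      = exp (- \<omega> * of_real t) * (LINT l:{0<..}|lborel. exp (- \<theta> * of_real l) * of_real (f l))" for \<omega> \<theta> t f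
    unfolding K mult.assoc by (rule set_integral_mult_right)
  note deriv = laplace_derivative[of "\<lambda>l. mean_balance l t" for t,
      OF diff mean_balance_mono mean_balance_nonneg mean_balance_le]
  have inner: "(LINT l:{0<..}|lborel. ?K \<omega> \<theta> t l * of_real (?D t l))
      = \<theta> * (LINT l:{0<..}|lborel. ?K \<omega> \<theta> t l * of_real (mean_balance l t))" if "0 < t" "0 < Re \<theta>" for t \<omega> \<theta>
    unfolding LK by (subst deriv(2)) (use that in auto)
  have D0: "0 \<le> ?D t l" if "0 < t" "0 < l" for t l
    by (rule LIMSEQ_le_const[OF deriv_LIMSEQ[OF diff]])
       (use that in \<open>auto intro!: exI[of _ 0] mult_nonneg_nonneg mean_balance_mono\<close>)
  \<comment> \<open>The series expansion is available for nonnegative \<open>l\<close> and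
    \<open>t\<close>, so the mean is cut off to the quadrant. Increasing \<open>l\<close> stays
    inside the quadrant, hence there the difference quotients of \<open>B\<close> are those of the
    mean.\<close>
  define B where "B p = indicator ?Q p *\<^sub>R (case p of (t, l) \<Rightarrow> mean_balance l t)" for p
  have [measurable]: "B \<in> borel_measurable ?P"
  proof (rule borel_measurable_LIMSEQ_real)
    let ?S = "\<lambda>n p. indicator ?Q p * (\<Sum>k<n. arrival_prob k (fst p) * accepted_mean k (snd p))"
    show "?S n \<in> borel_measurable ?P" for n by measurable
    show "(\<lambda>n. ?S n p) \<longlonglongrightarrow> B p" for p
      using mean_balance_sums[of "snd p" "fst p"]
      by (auto simp: B_def sums_def split: prod.split split_indicator)
  qed
  have D_meas: "(\<lambda>p. indicator ?Q p * (case p of (t, l) \<Rightarrow> ?D t l)) \<in> borel_measurable ?P"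
  proof (rule borel_measurable_LIMSEQ_real)
    let ?S = "\<lambda>n p. indicator ?Q p * ((B (fst p, snd p + 1 / real (Suc n)) - B p) * real (Suc n))"
    show "?S n \<in> borel_measurable ?P" for n by measurable
    show "(\<lambda>n. ?S n p) \<longlonglongrightarrow> indicator ?Q p * (case p of (t, l) \<Rightarrow> ?D t l)" for p
    proof (cases "p \<in> ?Q")
      case True
      then obtain t l where p: "p = (t, l)" "0 < t" "0 < l" by auto
      then have "0 < l + 1 / real (Suc n)" for n by (simp add: add_pos_pos)
      then show ?thesis
        using p deriv_LIMSEQ[OF diff[of l t]] by (simp add: B_def)
    qed simp
  qed
  let ?H = "\<lambda>\<omega> \<theta> p. indicator ?Q p *\<^sub>R (case p of (t, l) \<Rightarrow> ?K \<omega> \<theta> t l * of_real (?D t l))"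
  let ?E = "\<lambda>\<omega> \<theta> p. indicator ?Q p *\<^sub>R (case p of (t, l) \<Rightarrow> ?K \<omega> \<theta> t l * of_real (mean_balance l t))"
  have H_meas: "?H \<omega> \<theta> \<in> borel_measurable ?P" for \<omega> \<theta>
  proof -
    have eq: "?H \<omega> \<theta> = (\<lambda>p. ?K \<omega> \<theta> (fst p) (snd p) * of_real (indicator ?Q p * (case p of (t, l) \<Rightarrow> ?D t l)))"
      by (auto simp: fun_eq_iff split: split_indicator)
    have K_meas: "(\<lambda>p. ?K \<omega> \<theta> (fst p) (snd p)) \<in> borel_measurable ?P"
      by measurable
    show ?thesis
      unfolding eq by (intro borel_measurable_times K_meas measurable_compose[OF D_meas]) measurable
  qed
  \<comment> \<open>The derivative is nonnegative, so taking norms only replaces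
    \<open>\<omega>\<close> and \<open>\<theta>\<close> by their real parts.\<close>
  have norm_H: "complex_of_real (norm (?H \<omega> \<theta> (t, l))) = ?H (of_real c) (of_real d) (t, l)" for t l
  proof -
    have "complex_of_real (norm (?K \<omega> \<theta> t l)) = ?K (of_real c) (of_real d) t l"
      by (simp add: c_def d_def flip: exp_of_real)
    moreover have "norm (?H \<omega> \<theta> (t, l)) = indicator ?Q (t, l) * (norm (?K \<omega> \<theta> t l) * ?D t l)"
      using D0[of t l] by (simp add: norm_mult split: split_indicator)
    ultimately show ?thesis
      by (simp only: of_real_mult scaleR_conv_of_real prod.case)
  qed
  have slice: "integrable lborel (\<lambda>l. ?H \<omega> \<theta> (t, l))" if "0 < Re \<theta>" for t \<omega> \<theta>
  proof (cases "0 < t")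
    case True
    have "set_integrable lborel {0<..} (\<lambda>l. exp (- \<omega> * of_real t) * (exp (- \<theta> * of_real l) * of_real (?D t l)))"
      by (intro set_integrable_mult_right deriv(1)) (use True that in auto)
    moreover have "?H \<omega> \<theta> (t, l) = indicator {0<..} l *\<^sub>R
        (exp (- \<omega> * of_real t) * (exp (- \<theta> * of_real l) * of_real (?D t l)))" for l
      unfolding prod.case K using True by (simp add: indicator_times)
    ultimately show ?thesis
      unfolding set_integrable_def by (simp only:)
  qed simp
  have int_H: "integrable ?P (?H \<omega> \<theta>)"
  proof (rule lborel_pair.Fubini_integrable[OF H_meas])
    have E: "integrable ?P (?E (of_real c) (of_real d))"
      using double_laplace_mean_balance(1)[of "of_real d" "of_real c"] cd unfolding set_integrable_def by simp
    \<comment> \<open>The inner identity at the real parameters; for \<open>t \<le> 0\<close> both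
      sides vanish.\<close>
    have "(LINT l|lborel. ?H (of_real c) (of_real d) (t, l)) = of_real d * (LINT l|lborel. ?E (of_real c) (of_real d) (t, l))" for t
    proof (cases "0 < t")
      case True
      then show ?thesis
        using inner[of t "of_real d" "of_real c"] cd
        unfolding set_lebesgue_integral_def by (simp add: indicator_times)
    qed simp
    moreover have "complex_of_real (LINT l|lborel. norm (?H \<omega> \<theta> (t, l))) = (LINT l|lborel. ?H (of_real c) (of_real d) (t, l))" for t
      unfolding integral_complex_of_real[symmetric] norm_H ..
    ultimately have "complex_integrable lborel (\<lambda>t. complex_of_real (LINT l|lborel. norm (?H \<omega> \<theta> (t, l))))"
      using lborel_pair.integrable_fst'[OF E] by (simp only: integrable_mult_right)
    then show "integrable lborel (\<lambda>t. LINT l|lborel. norm (?H \<omega> \<theta> (t, l)))"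
      by (simp only: complex_of_real_integrable_eq)
    show "AE t in lborel. integrable lborel (\<lambda>l. ?H \<omega> \<theta> (t, l))"
      using slice \<theta> by simp
  qed
  then show ?int unfolding set_integrable_def .
  have "(LINT t:{0<..}|lborel. LINT l:{0<..}|lborel. ?K \<omega> \<theta> t l * of_real (?D t l))
      = (LINT t:{0<..}|lborel. \<theta> * (LINT l:{0<..}|lborel. ?K \<omega> \<theta> t l * of_real (mean_balance l t)))"
    by (rule set_lebesgue_integral_cong) (use inner \<theta> in auto)
  then show ?eq
    by (simp only: set_integral_mult_right)
qed

end

theorem mainTheorem1:
  fixes M :: "'a measure"
    and \<xi> \<tau> :: "nat \<Rightarrow> 'a \<Rightarrow> real"
    and F G :: "real \<Rightarrow> real"
    and \<theta> \<omega> :: complex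
  assumes "prob_space M"
    and "prob_space.indep_vars M (\<lambda>_. borel) \<xi> UNIV"
    and "prob_space.indep_vars M (\<lambda>_. borel) \<tau> UNIV"
    and "prob_space.indep_set M
           (process_events M UNIV borel \<xi>)
           (process_events M {0..} (count_space UNIV) (renewal_count \<tau>))"
    and "\<And>i x. x \<in> space M \<Longrightarrow> 0 \<le> \<xi> i x"
    and "\<And>i x. x \<in> space M \<Longrightarrow> 0 < \<tau> i x"
    and "\<And>i. cdf (distr M borel (\<xi> i)) = F"
    and "\<And>i. cdf (distr M borel (\<tau> i)) = G"
    and "abscissa_of_convergence F < 0"
    and "abscissa_of_convergence G < 0"
    and "0 < Re \<theta>" and "0 < Re \<omega>"
  defines "EB \<equiv> \<lambda>l t. LINT x|M. balance \<xi> \<tau> l t x"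
  shows
    "set_integrable (lborel \<Otimes>\<^sub>M lborel) ({0<..} \<times> {0<..})
       (\<lambda>(t, l). exp (- (\<omega> * of_real t + \<theta> * of_real l)) * of_real (EB l t)) \<and>
     (LINT t:{0<..}|lborel. LINT l:{0<..}|lborel.
        exp (- (\<omega> * of_real t + \<theta> * of_real l)) * of_real (EB l t)) =
     - (laplace_stieltjes G \<omega> /
          (\<theta> * \<omega> * (1 - laplace_stieltjes G \<omega> * laplace_stieltjes F \<theta>)))
       * deriv (laplace_stieltjes F) \<theta> \<and>
     ((\<forall>l>0. \<forall>t>0. (\<lambda>l. EB l t) differentiable (at l)) \<longrightarrow>
      set_integrable (lborel \<Otimes>\<^sub>M lborel) ({0<..} \<times> {0<..})
        (\<lambda>(t, l). exp (- (\<omega> * of_real t + \<theta> * of_real l)) * of_real (deriv (\<lambda>l. EB l t) l)) \<and>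
      (LINT t:{0<..}|lborel. LINT l:{0<..}|lborel.
         exp (- (\<omega> * of_real t + \<theta> * of_real l)) * of_real (deriv (\<lambda>l. EB l t) l)) =
      - (laplace_stieltjes G \<omega> /
           (\<omega> * (1 - laplace_stieltjes G \<omega> * laplace_stieltjes F \<theta>)))
        * deriv (laplace_stieltjes F) \<theta>)"
proof -
  interpret purchase_process M \<xi> \<tau> F G
    using assms(1-8) by (auto simp: purchase_process_def purchase_process_axioms_def)
  have [simp]: "\<theta> \<noteq> 0" using \<open>0 < Re \<theta>\<close> by auto
  note part1 = double_laplace_mean_balance[OF \<open>0 < Re \<theta>\<close> \<open>0 < Re \<omega>\<close>]
  \<comment> \<open>The factor \<open>\<theta>\<close> produced by the derivative cancels the one in
    the denominator of the first formula.\<close>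
  note part2 = double_laplace_deriv_mean_balance[OF \<open>0 < Re \<theta>\<close> \<open>0 < Re \<omega>\<close>, unfolded part1(2)]
  show ?thesis
    unfolding EB_def
  proof (intro conjI impI)
    assume diff: "\<forall>l>0. \<forall>t>0. (\<lambda>l. mean_balance l t) differentiable (at l)"
    show "set_integrable (lborel \<Otimes>\<^sub>M lborel) ({0<..} \<times> {0<..})
        (\<lambda>(t, l). exp (- (\<omega> * of_real t + \<theta> * of_real l)) * of_real (deriv (\<lambda>l. mean_balance l t) l))"
      using part2(1) diff by blast
    show "(LINT t:{0<..}|lborel. LINT l:{0<..}|lborel.
         exp (- (\<omega> * of_real t + \<theta> * of_real l)) * of_real (deriv (\<lambda>l. mean_balance l t) l)) =
      - (laplace_stieltjes G \<omega> /
           (\<omega> * (1 - laplace_stieltjes G \<omega> * laplace_stieltjes F \<theta>)))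
        * deriv (laplace_stieltjes F) \<theta>"
      using part2(2) diff by simp
  qed (rule part1)+
qed

end
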